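(* Fix a choice of $(\beta,\mu,t,L,d)$. The model is RS if and only if $$\sup_{0<s<R_1(\mu;t)}g_\beta(s)=g_\beta(R_1(\mu;t)),$$ where $$g_\beta(s)=\beta^2B\left(\frac{2s}{\beta}\right)+sK(s;t)-\frac1{L^d}\log\det(K(s;t)I-t\Delta)-s\left(2\beta B'\left(\frac2\beta R_1(\mu;t)\right)+\mu\right).$$ Moreover, when the model is RS, the free energy is given by $$\mathcal{P}_{\beta,q_c}(\zeta_c)=\frac12\left(\log\left(\frac{2\pi}{\beta}\right)+\frac1{L^d}\log\det(\mu I-t\Delta)+\beta^2\left(B(0)-B\left(\frac2\beta R_1(\mu;t)\right)\right)\right),$$ and, with $q_{L,\beta}:=-2B'\left(\frac2\beta R_1(\mu;t)\right)R_2(\mu;t)$, the saddle point pair is given by $$(\zeta_c,q_c)=\big(\delta_{q_{L,\beta}},\;q_{L,\beta}+\beta^{-1}R_1(\mu;t)\big).$$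
   Context: Fix integers $L\ge1$, $d\ge0$ and reals $\mu>0$, $t>0$, $\beta>0$, $h\in\mathbb{R}$. $\Omega=[[1,L]]^d$ is regarded as a graph with periodic boundary conditions (discrete torus), $|\Omega|=L^d$, and $\Delta$ is its graph Laplacian with the sign convention that $\Delta$ is negative semi-definite. For $A\in\mathbb R^{\Omega\times\Omega}$, $\mathrm{tr}(A)=|\Omega|^{-1}\sum_{x\in\Omega}A_{xx}$. $B(x)=\int_0^\infty e^{-\lambda^2x}\nu(d\lambda)$ for a finite non-negative measure $\nu$ on $(0,\infty)$ with $\int_0^\infty e^{\epsilon\lambda^2}\nu(d\lambda)<\infty$ for some $\epsilon>0$. For $i\ge1$, $R_i(u;t)=\mathrm{tr}(uI-t\Delta)^{-i}$, $u>0$; $K(\cdot;t):(0,\infty)\to(0,\infty)$ is the functional inverse of $R_1(\cdot;t)$, and $K'$ is its derivative in the first argument. $\mathscr{Y}(q)$ is the set of probability measures on $[0,q]$ whose support does not contain $q$. For $\zeta\in\mathscr{Y}(q)$, let $\delta(s)=\int_s^q\zeta([0,u])du$, choose $q_*\in(0,q)$ with $\zeta([q_*,q])=0$, and set $$\mathcal{P}_{\beta,q}(\zeta)=\frac12\Big(\log\frac{2\pi}{\beta}+\frac{\beta h^2}{\mu}-\beta\mu q+\beta(q-q_* )K(\beta(q-q_* );t)-\frac1{L^d}\log\det\big(K(\beta(q-q_* );t)I-t\Delta\big)+\int_0^{q_*}\beta K(\beta\delta(u);t)du-2\beta^2\int_0^q\zeta([0,u])B'(2(q-u))du\Big)$$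 (independent of the choice of $q_*$). The pair $(q_c,\zeta_c)$ is the unique pair $(q,\zeta)$ with $q\in(0,\infty)$, $\zeta\in\mathscr{Y}(q)$ such that, with $F_{\beta,q}(s)=-2B'(2(q-s))+\int_0^sK'(\beta\delta(u);t)du$ and $f_{\beta,q}(s)=\int_0^sF_{\beta,q}(u)du$ for $s\in(0,q)$ (extended to $[0,q]$ by its limits), $$\beta\int_0^q\zeta([0,u])du=R_1(\mu;t),\qquad \zeta\Big(\big\{s\in[0,q]:f_{\beta,q}(s)=\sup_{0<s'<q}f_{\beta,q}(s')\big\}\Big)=1.$$ The free energy is the limit $\lim_N N^{-1}L^{-d}\mathbb{E}\log\int_{(\mathbb{R}^N)^\Omega}e^{-\beta\mathcal{H}_N(\mathbf u)}d\mathbf u$, identified in the paper with $\mathcal{P}_{\beta,q_c}(\zeta_c)$, for the elastic manifold Hamiltonian $\mathcal{H}_N(\mathbf{u})=\tfrac12\sum_{x,y\in\Omega}(\mu I-t\Delta)_{xy}(\mathbf{u}(x),\mathbf{u}(y))+\sum_{x\in\Omega}V_{N,x}(\mathbf{u}(x))+\sqrt{N}h\sum_{x\in\Omega}\mathbf{u}_1(x)$, where $(\cdot,\cdot)$ is the Euclidean inner product, $V_{N,x}$ are i.i.d. centered Gaussian fields on $\mathbb{R}^N$ with covariance $N B(\|u-v\|^2/N)$ and $\mathbf u_1(x)$ is the first coordinate of $\mathbf u(x)\in\mathbb{R}^N$. The model is called replica symmetric (RS), for a given choice of parameters, if $\zeta_c$ is a Dirac mass. $\delta_a$ denotes the Dirac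 mass at $a$.
   Formalization: The printed free-energy formula is false for the given functional; the formal one has −L^{-d} log det(μI−tΔ) instead of +, and includes the missing term βh²/μ (e.g. d=0, L=1, ν=0, h=0 gives −log μ, not +log μ). *)

theory Defs
  imports
    "HOL-Probability.Probability"
    "HOL-Number_Theory.Cong"
    "Jordan_Normal_Form.Determinant"
    "Jordan_Normal_Form.Gauss_Jordan_Elimination"
begin

section \<open>The discrete torus and its Laplacian\<close>

definition torus :: "nat \<Rightarrow> nat \<Rightarrow> nat list set" where
  "torus L d = {x. length x = d \<and> set x \<subseteq> {1..L}}"

text \<open>
  The torus is a simple graph: for \<open>L = 1\<close> there are no edges, and for \<open>L = 2\<close> the two
  neighbours of a site in a given direction coincide and are joined to it by a single edge.
\<close>

definition torus_adj :: "nat \<Rightarrow> nat \<Rightarrow> nat list \<Rightarrow> nat list \<Rightarrow> bool" where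
  "torus_adj L d x y \<longleftrightarrow> x \<in> torus L d \<and> y \<in> torus L d \<and> x \<noteq> y \<and>
     (\<exists>k<d. ([x ! k = y ! k + 1] (mod L) \<or> [y ! k = x ! k + 1] (mod L)) \<and>
            (\<forall>j<d. j \<noteq> k \<longrightarrow> x ! j = y ! j))"

definition torus_laplacian :: "nat \<Rightarrow> nat \<Rightarrow> nat list \<Rightarrow> nat list \<Rightarrow> real" where
  "torus_laplacian L d x y =
     (if x = y then - real (card {z. torus_adj L d x z})
      else if torus_adj L d x y then 1 else 0)"

text \<open>
  Matrices over the torus are written as \<open>L ^ d \<times> L ^ d\<close> matrices, the rows and columns being
  labelled by the base-\<open>L\<close> enumeration of the sites.
\<close>

definition site :: "nat \<Rightarrow> nat \<Rightarrow> nat \<Rightarrow> nat list" where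
  "site L d i = map (\<lambda>k. i div L ^ k mod L + 1) [0..<d]"

lemma digits_inj:
  assumes "L \<ge> 1" "i < L ^ d" "j < L ^ d"
    and "\<forall>k<d. i div L ^ k mod L = j div L ^ k mod L"
  shows "i = (j::nat)"
  using assms(2-4)
proof (induction d arbitrary: i j)
  case (Suc d)
  have "i div L < L ^ d" "j div L < L ^ d"
    using Suc.prems(1,2) by (auto simp: less_mult_imp_div_less mult.commute)
  moreover have "\<forall>k<d. i div L div L ^ k mod L = j div L div L ^ k mod L"
    using Suc.prems(3) by (metis Suc_less_eq div_mult2_eq power_Suc)
  ultimately have "i div L = j div L" by (rule Suc.IH)
  moreover have "i mod L = j mod L"
    using Suc.prems(3) by (metis div_by_1 power_0 zero_less_Suc)
  ultimately show ?case by (metis div_mult_mod_eq)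
qed auto

lemma torus_eq_lists: "torus L d = {x. set x \<subseteq> {1..L} \<and> length x = d}"
  by (auto simp: torus_def)

lemma card_torus: "card (torus L d) = L ^ d"
  by (simp add: torus_eq_lists card_lists_length_eq)

lemma site_bij:
  assumes "L \<ge> 1"
  shows "bij_betw (site L d) {..<L ^ d} (torus L d)"
proof -
  have inj: "inj_on (site L d) {..<L ^ d}"
  proof (rule inj_onI)
    fix i j assume ij: "i \<in> {..<L ^ d}" "j \<in> {..<L ^ d}" "site L d i = site L d j"
    have "\<forall>k<d. i div L ^ k mod L = j div L ^ k mod L"
      using ij(3) by (auto simp: site_def)
    then show "i = j" using ij digits_inj[OF assms] by auto
  qed
  have "site L d ` {..<L ^ d} \<subseteq> torus L d"
    using assms by (auto simp: site_def torus_def Suc_le_eq)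
  moreover have "card (site L d ` {..<L ^ d}) = card (torus L d)"
    using inj by (simp add: card_image card_torus)
  moreover have "finite (torus L d)"
    by (simp add: torus_eq_lists finite_lists_length_eq)
  ultimately have "site L d ` {..<L ^ d} = torus L d"
    by (intro card_subset_eq) auto
  with inj show ?thesis by (simp add: bij_betw_def)
qed

definition laplacian :: "nat \<Rightarrow> nat \<Rightarrow> real mat" where
  "laplacian L d =
     mat (L ^ d) (L ^ d) (\<lambda>(i, j). torus_laplacian L d (site L d i) (site L d j))"

definition shifted :: "nat \<Rightarrow> nat \<Rightarrow> real \<Rightarrow> real \<Rightarrow> real mat" where
  "shifted L d t u = u \<cdot>\<^sub>m 1\<^sub>m (L ^ d) - t \<cdot>\<^sub>m laplacian L d"

definition logdet :: "nat \<Rightarrow> nat \<Rightarrow> real \<Rightarrow> real \<Rightarrow> real" where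
  "logdet L d t u = ln (Determinant.det (shifted L d t u))"

definition ntrace :: "real mat \<Rightarrow> real" where
  "ntrace A = (\<Sum>i<dim_row A. A $$ (i, i)) / real (dim_row A)"

definition R :: "nat \<Rightarrow> nat \<Rightarrow> real \<Rightarrow> nat \<Rightarrow> real \<Rightarrow> real" where
  "R L d t i u = ntrace (the (mat_inverse (shifted L d t u)) ^\<^sub>m i)"

definition K :: "nat \<Rightarrow> nat \<Rightarrow> real \<Rightarrow> real \<Rightarrow> real" where
  "K L d t = the_inv_into {0<..} (R L d t 1)"

section \<open>The covariance function\<close>

text \<open>A measure on \<open>(0, \<infinity>)\<close> is a Borel measure on the line giving no mass to \<open>(-\<infinity>, 0]\<close>.\<close>

definition spectral_measure :: "real measure \<Rightarrow> bool" where
  "spectral_measure \<nu> \<longleftrightarrow>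
     sets \<nu> = sets borel \<and> finite_measure \<nu> \<and> emeasure \<nu> {..0} = 0 \<and>
     (\<exists>\<epsilon>>0. (\<integral>\<^sup>+x. ennreal (exp (\<epsilon> * x\<^sup>2)) \<partial>\<nu>) < \<infinity>)"

definition B :: "real measure \<Rightarrow> real \<Rightarrow> real" where
  "B \<nu> x = (\<integral>y. exp (- y\<^sup>2 * x) \<partial>\<nu>)"

section \<open>The Parisi functional and the saddle point pair\<close>

definition supp :: "real measure \<Rightarrow> real set" where
  "supp \<zeta> = {x. \<forall>U. open U \<and> x \<in> U \<longrightarrow> emeasure \<zeta> U > 0}"

definition Y :: "real \<Rightarrow> real measure set" where
  "Y q = {\<zeta>. prob_space \<zeta> \<and> sets \<zeta> = sets borel \<and> measure \<zeta> {0..q} = 1 \<and> q \<notin> supp \<zeta>}"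

definition delta :: "real \<Rightarrow> real measure \<Rightarrow> real \<Rightarrow> real" where
  "delta q \<zeta> s = integral {s..q} (\<lambda>u. measure \<zeta> {0..u})"

definition parisi_at ::
  "nat \<Rightarrow> nat \<Rightarrow> real \<Rightarrow> real \<Rightarrow> real \<Rightarrow> real measure \<Rightarrow> real \<Rightarrow> real \<Rightarrow> real measure \<Rightarrow> real \<Rightarrow> real"
where
  "parisi_at L d \<mu> t h \<nu> \<beta> q \<zeta> qs = 1/2 *
     (ln (2 * pi / \<beta>) + \<beta> * h\<^sup>2 / \<mu> - \<beta> * \<mu> * q
      + \<beta> * (q - qs) * K L d t (\<beta> * (q - qs))
      - 1 / real (L ^ d) * logdet L d t (K L d t (\<beta> * (q - qs)))
      + integral {0..qs} (\<lambda>u. \<beta> * K L d t (\<beta> * delta q \<zeta> u))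
      - 2 * \<beta>\<^sup>2 * integral {0..q} (\<lambda>u. measure \<zeta> {0..u} * deriv (B \<nu>) (2 * (q - u))))"

text \<open>For \<open>\<zeta> \<in> Y q\<close> the value does not depend on which admissible \<open>qs\<close> is chosen.\<close>

definition parisi ::
  "nat \<Rightarrow> nat \<Rightarrow> real \<Rightarrow> real \<Rightarrow> real \<Rightarrow> real measure \<Rightarrow> real \<Rightarrow> real \<Rightarrow> real measure \<Rightarrow> real"
where
  "parisi L d \<mu> t h \<nu> \<beta> q \<zeta> = parisi_at L d \<mu> t h \<nu> \<beta> q \<zeta>
     (SOME qs. 0 < qs \<and> qs < q \<and> measure \<zeta> {qs..q} = 0)"

definition F ::
  "nat \<Rightarrow> nat \<Rightarrow> real \<Rightarrow> real measure \<Rightarrow> real \<Rightarrow> real \<Rightarrow> real measure \<Rightarrow> real \<Rightarrow> real" where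
  "F L d t \<nu> \<beta> q \<zeta> s = - 2 * deriv (B \<nu>) (2 * (q - s))
     + integral {0..s} (\<lambda>u. deriv (K L d t) (\<beta> * delta q \<zeta> u))"

definition f_int ::
  "nat \<Rightarrow> nat \<Rightarrow> real \<Rightarrow> real measure \<Rightarrow> real \<Rightarrow> real \<Rightarrow> real measure \<Rightarrow> real \<Rightarrow> real" where
  "f_int L d t \<nu> \<beta> q \<zeta> s = integral {0..s} (F L d t \<nu> \<beta> q \<zeta>)"

text \<open>
  The extension of \<open>f_int\<close> to the closed interval takes values in the extended reals, since
  the limit at \<open>q\<close> is \<open>-\<infinity>\<close>.
\<close>

definition f_ext ::
  "nat \<Rightarrow> nat \<Rightarrow> real \<Rightarrow> real measure \<Rightarrow> real \<Rightarrow> real \<Rightarrow> real measure \<Rightarrow> real \<Rightarrow> ereal" where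
  "f_ext L d t \<nu> \<beta> q \<zeta> s =
     (if s \<in> {0<..<q} then ereal (f_int L d t \<nu> \<beta> q \<zeta> s)
      else Lim (at s within {0<..<q}) (\<lambda>r. ereal (f_int L d t \<nu> \<beta> q \<zeta> r)))"

definition saddle_pair ::
  "nat \<Rightarrow> nat \<Rightarrow> real \<Rightarrow> real \<Rightarrow> real measure \<Rightarrow> real \<Rightarrow> real \<Rightarrow> real measure \<Rightarrow> bool" where
  "saddle_pair L d \<mu> t \<nu> \<beta> q \<zeta> \<longleftrightarrow>
     0 < q \<and> \<zeta> \<in> Y q \<and>
     \<beta> * integral {0..q} (\<lambda>u. measure \<zeta> {0..u}) = R L d t 1 \<mu> \<and>
     measure \<zeta> {s \<in> {0..q}. f_ext L d t \<nu> \<beta> q \<zeta> s =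
       (SUP s'\<in>{0<..<q}. ereal (f_int L d t \<nu> \<beta> q \<zeta> s'))} = 1"

text \<open>Replica symmetry, stated for the measure component of the saddle point pair.\<close>

definition replica_symmetric :: "real measure \<Rightarrow> bool" where
  "replica_symmetric \<zeta> \<longleftrightarrow> (\<exists>a. \<zeta> = return borel a)"

definition g ::
  "nat \<Rightarrow> nat \<Rightarrow> real \<Rightarrow> real \<Rightarrow> real measure \<Rightarrow> real \<Rightarrow> real \<Rightarrow> real" where
  "g L d \<mu> t \<nu> \<beta> s = \<beta>\<^sup>2 * B \<nu> (2 * s / \<beta>) + s * K L d t s
     - 1 / real (L ^ d) * logdet L d t (K L d t s)
     - s * (2 * \<beta> * deriv (B \<nu>) (2 / \<beta> * R L d t 1 \<mu>) + \<mu>)"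

definition qL :: "nat \<Rightarrow> nat \<Rightarrow> real \<Rightarrow> real \<Rightarrow> real measure \<Rightarrow> real \<Rightarrow> real" where
  "qL L d \<mu> t \<nu> \<beta> = - 2 * deriv (B \<nu>) (2 / \<beta> * R L d t 1 \<mu>) * R L d t 2 \<mu>"

end

theory Submission
  imports Defs "Jordan_Normal_Form.Schur_Decomposition"
begin

text \<open>
  Write \<open>r = R\<^sub>1(\<mu>)\<close>. The constraint on a saddle pair \<open>(q, \<zeta>)\<close> says that \<open>\<zeta>\<close> has mean \<open>q - r / \<beta>\<close>,
  so a Dirac mass must sit there. In that case \<open>f\<close> to the right of the mean is, up to the factor
  \<open>\<beta>\<^sup>2\<close>, the function \<open>g\<close> in the variable \<open>\<beta> (q - s)\<close>, and \<open>f' = 0\<close> at the mean determines its value.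
  Conversely, if \<open>g\<close> is maximal at \<open>r\<close> and \<open>\<zeta>\<close> is not a Dirac mass, then \<open>f\<close> has maximisers on both
  sides of the mean; comparing \<open>f\<close> with its replica symmetric counterpart, using
  \<open>\<delta>(s) \<le> min (r / \<beta>) (q - s)\<close> and the monotonicity of \<open>K'\<close>, gives \<open>f' \<ge> 0\<close> at the mean from the right
  maximiser and \<open>f' < 0\<close> from the left one.
\<close>

section \<open>Resolvents of the Laplacian\<close>

text \<open>The criterion tests g only on (0, r), that is f only to the right of the mean; it says
  nothing directly about points to the left. These are controlled to second order. The coefficient
  of s in g is such that g'(r) = 0, so a maximum at the right end point r forces g''(r) = 4 B''(2 r
  / beta) + K'(r) <= 0. For s < mean, concavity of B' and the bound r / beta on \<open>D\<close>
  give F(mean) - F(s) <= (mean - s) g''(r), so a condition at the single point r settles the whole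
  left side. The comparisons rest on K' being continuous and strictly increasing. As K is given only
  as an inverse function, this is obtained by writing R_1 and R_2 as averages of powers of 1 / (u +
  a_i), where the a_i are the eigenvalues of - t Delta. The eigenvalue 0 makes R_1 unbounded near 0,
  so that K is defined on all of (0, infinity).\<close>

lemma upper_triangular_inverse:
  fixes T N :: "'a::field mat"
  assumes T: "T \<in> carrier_mat n n" and N: "N \<in> carrier_mat n n"
    and ut: "upper_triangular T" and nz: "\<And>i. i < n \<Longrightarrow> T $$ (i, i) \<noteq> 0"
    and TN: "T * N = 1\<^sub>m n"
  shows "upper_triangular N" "\<And>i. i < n \<Longrightarrow> N $$ (i, i) = 1 / T $$ (i, i)"
proof -
  have entry: "(\<Sum>k<n. T $$ (i, k) * N $$ (k, j)) = (if i = j then 1 else 0)"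
    if "i < n" "j < n" for i j
  proof -
    have "(T * N) $$ (i, j) = (\<Sum>k<n. T $$ (i, k) * N $$ (k, j))"
      using that T N by (auto simp: scalar_prod_def atLeast0LessThan)
    then show ?thesis using that TN by simp
  qed
  have single: "(\<Sum>k<n. T $$ (i, k) * N $$ (k, j)) = T $$ (i, i) * N $$ (i, j)"
    if "i < n" "\<And>k. k < n \<Longrightarrow> i < k \<Longrightarrow> N $$ (k, j) = 0" for i j
  proof -
    have "T $$ (i, k) * N $$ (k, j) = 0" if "k < n" "k \<noteq> i" for k
      using upper_triangularD[OF ut, of k i] T \<open>i < n\<close> \<open>\<And>k. k < n \<Longrightarrow> i < k \<Longrightarrow> N $$ (k, j) = 0\<close> that
      by (cases "k < i") auto
    then have "(\<Sum>k<n. T $$ (i, k) * N $$ (k, j)) = (\<Sum>k\<in>{i}. T $$ (i, k) * N $$ (k, j))"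
      using that by (intro sum.mono_neutral_right) auto
    then show ?thesis by simp
  qed
  \<comment> \<open>Back substitution from the last row upwards: once the rows below i are known to
    vanish in column j, row i of \<open>T * N = 1\<close> reduces to one product.\<close>
  have zero: "N $$ (i, j) = 0" if "i < n" "j < i" for i j
    using that
  proof (induction "n - i" arbitrary: i rule: less_induct)
    case less
    have "N $$ (k, j) = 0" if "k < n" "i < k" for k
      using that less.prems by (intro less.hyps) auto
    then have "T $$ (i, i) * N $$ (i, j) = 0"
      using single[of i j] entry[of i j] less.prems by simp
    then show ?case using nz less.prems by simp
  qed
  then show "upper_triangular N"
    using N by auto
  show "N $$ (i, i) = 1 / T $$ (i, i)" if "i < n" for i
    using single[of i i] entry[of i i] zero that nz[OF that] by (simp add: field_simps)
qed

lemma upper_triangular_pow: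
  fixes N :: "'a::comm_ring_1 mat"
  assumes N: "N \<in> carrier_mat n n" and ut: "upper_triangular N"
  shows "upper_triangular (N ^\<^sub>m k) \<and> (\<forall>i<n. (N ^\<^sub>m k) $$ (i, i) = (N $$ (i, i)) ^ k)"
proof (induction k)
  case 0
  then show ?case using N by simp
next
  case (Suc k)
  let ?M = "N ^\<^sub>m k"
  have M: "?M \<in> carrier_mat n n" using N by simp
  have zM: "?M $$ (i, l) = 0" if "l < i" "i < n" for i l
    using Suc that M by (metis carrier_matD(1) upper_triangularD)
  have zN: "N $$ (i, l) = 0" if "l < i" "i < n" for i l
    using ut that N by (metis carrier_matD(1) upper_triangularD)
  have entry: "(N ^\<^sub>m Suc k) $$ (i, j) = (\<Sum>l<n. ?M $$ (i, l) * N $$ (l, j))"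
    if "i < n" "j < n" for i j
    using that M N by (auto simp: scalar_prod_def atLeast0LessThan)
  have "(N ^\<^sub>m Suc k) $$ (i, j) = 0" if "i < n" "j < i" for i j
  proof -
    have "?M $$ (i, l) * N $$ (l, j) = 0" if "l < n" for l
      using zM[of l i] zN[of j l] \<open>i < n\<close> \<open>j < i\<close> that by (cases "l < i") auto
    then show ?thesis using entry that by simp
  qed
  then have "upper_triangular (N ^\<^sub>m Suc k)"
    using M N by (auto intro!: upper_triangularI)
  moreover have "(N ^\<^sub>m Suc k) $$ (i, i) = (N $$ (i, i)) ^ Suc k" if "i < n" for i
  proof -
    have "?M $$ (i, l) * N $$ (l, i) = 0" if "l < n" "l \<noteq> i" for l
      using zM[of l i] zN[of i l] \<open>i < n\<close> that by (cases "l < i") auto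
    then have "(\<Sum>l<n. ?M $$ (i, l) * N $$ (l, i)) = (\<Sum>l\<in>{i}. ?M $$ (i, l) * N $$ (l, i))"
      using that by (intro sum.mono_neutral_right) auto
    then show ?thesis using entry[OF that that] Suc that by simp
  qed
  ultimately show ?case by blast
qed

lemma diag_sum_commute:
  fixes A C :: "'a::comm_ring_1 mat"
  assumes "A \<in> carrier_mat n n" "C \<in> carrier_mat n n"
  shows "(\<Sum>i<n. (A * C) $$ (i, i)) = (\<Sum>i<n. (C * A) $$ (i, i))"
proof -
  have "(\<Sum>i<n. (A * C) $$ (i, i)) = (\<Sum>i<n. \<Sum>k<n. A $$ (i, k) * C $$ (k, i))"
    using assms by (auto simp: scalar_prod_def atLeast0LessThan)
  also have "\<dots> = (\<Sum>k<n. \<Sum>i<n. C $$ (k, i) * A $$ (i, k))"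
    by (subst sum.swap) (simp add: mult.commute)
  also have "\<dots> = (\<Sum>k<n. (C * A) $$ (k, k))"
    using assms by (auto simp: scalar_prod_def atLeast0LessThan)
  finally show ?thesis .
qed

lemma diag_sum_similar:
  fixes A :: "'a::comm_ring_1 mat"
  assumes "similar_mat_wit A C P Q" "A \<in> carrier_mat n n"
  shows "(\<Sum>i<n. A $$ (i, i)) = (\<Sum>i<n. C $$ (i, i))"
proof -
  have car: "C \<in> carrier_mat n n" "P \<in> carrier_mat n n" "Q \<in> carrier_mat n n"
    and QP: "Q * P = 1\<^sub>m n" and A: "A = P * C * Q"
    using similar_mat_witD2[OF assms(2,1)] by auto
  have "(\<Sum>i<n. A $$ (i, i)) = (\<Sum>i<n. (Q * (P * C)) $$ (i, i))"
    unfolding A using car by (intro diag_sum_commute) auto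
  also have "Q * (P * C) = C"
    using car QP by (simp add: assoc_mult_mat[symmetric, of Q n n P n C n])
  finally show ?thesis .
qed

text \<open>The eigenvalues and the diagonal of \<open>T\<close> are the roots of one characteristic
  polynomial, which splits over the complex numbers. A triangular form is as good as a diagonal one
  here, because determinants and traces of powers of the inverse read only the diagonal.\<close>

lemma complex_triangularisation:
  fixes A :: "complex mat"
  assumes A: "A \<in> carrier_mat n n"
  obtains T P Q where "similar_mat_wit A T P Q" "upper_triangular T" "T \<in> carrier_mat n n"
    "\<And>e. eigenvalue A e \<longleftrightarrow> (\<exists>i<n. e = T $$ (i, i))"
proof -
  obtain as where as: "char_poly A = (\<Prod>a\<leftarrow>as. [:- a, 1:])"
    using char_poly_factorized[OF A] by blast
  define T where "T = schur_upper_triangular A as"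
  have T: "T \<in> carrier_mat n n" "upper_triangular T" "similar_mat A T"
    using schur_upper_triangular[OF A as] by (auto simp: T_def)
  have "char_poly A = (\<Prod>a\<leftarrow>diag_mat T. [:- a, 1:])"
    using char_poly_similar[OF T(3)] char_poly_upper_triangular[OF T(1,2)] by simp
  then have "eigenvalue A e \<longleftrightarrow> (\<exists>i<n. e = T $$ (i, i))" for e
    unfolding eigenvalue_root_char_poly[OF A] using T(1)
    by (auto simp: poly_prod_list prod_list_zero_iff diag_mat_def)
  then show thesis
    using T that unfolding similar_mat_def by blast
qed

section \<open>The torus Laplacian: symmetry, zero row sums, nonpositive spectrum\<close>

lemma torus_adj_sym: "torus_adj L d x y \<longleftrightarrow> torus_adj L d y x"
  unfolding torus_adj_def by metis

lemma torus_laplacian_sym: "torus_laplacian L d x y = torus_laplacian L d y x"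
  unfolding torus_laplacian_def using torus_adj_sym by auto

lemma finite_torus: "finite (torus L d)"
  by (simp add: torus_eq_lists finite_lists_length_eq)

lemma torus_laplacian_row_sum:
  assumes "x \<in> torus L d"
  shows "(\<Sum>y\<in>torus L d. torus_laplacian L d x y) = 0"
proof -
  have sub: "{z. torus_adj L d x z} \<subseteq> torus L d - {x}"
    by (auto simp: torus_adj_def)
  have "(\<Sum>y\<in>torus L d. torus_laplacian L d x y)
      = - real (card {z. torus_adj L d x z}) + (\<Sum>y\<in>torus L d - {x}. torus_laplacian L d x y)"
    by (subst sum.remove[OF finite_torus assms]) (simp add: torus_laplacian_def)
  also have "(\<Sum>y\<in>torus L d - {x}. torus_laplacian L d x y)
      = (\<Sum>y\<in>torus L d - {x}. if y \<in> {z. torus_adj L d x z} then 1 else 0)"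
    by (intro sum.cong) (auto simp: torus_laplacian_def)
  also have "\<dots> = real (card {z. torus_adj L d x z})"
    using sub finite_torus[of L d]
    by (subst sum.inter_restrict[symmetric]) (auto simp: Int_absorb1)
  finally show ?thesis by simp
qed

lemma laplacian_carrier [simp]: "laplacian L d \<in> carrier_mat (L ^ d) (L ^ d)"
  by (simp add: laplacian_def)

lemma dim_laplacian [simp]: "dim_row (laplacian L d) = L ^ d" "dim_col (laplacian L d) = L ^ d"
  by (simp_all add: laplacian_def)

lemma laplacian_sym:
  assumes "i < L ^ d" "j < L ^ d"
  shows "laplacian L d $$ (i, j) = laplacian L d $$ (j, i)"
  using assms by (simp add: laplacian_def torus_laplacian_sym)

lemma laplacian_offdiag_nonneg:
  assumes "L \<ge> 1" "i < L ^ d" "j < L ^ d" "i \<noteq> j"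
  shows "laplacian L d $$ (i, j) \<ge> 0"
proof -
  have "site L d i \<noteq> site L d j"
    using site_bij[OF assms(1), of d] assms by (auto simp: bij_betw_def inj_on_def)
  then show ?thesis using assms by (simp add: laplacian_def torus_laplacian_def)
qed

lemma laplacian_row_sum:
  assumes "L \<ge> 1" "i < L ^ d"
  shows "(\<Sum>j<L ^ d. laplacian L d $$ (i, j)) = 0"
proof -
  have "(\<Sum>j<L ^ d. laplacian L d $$ (i, j))
      = (\<Sum>j<L ^ d. torus_laplacian L d (site L d i) (site L d j))"
    using assms by (simp add: laplacian_def)
  also have "\<dots> = (\<Sum>y\<in>torus L d. torus_laplacian L d (site L d i) y)"
    by (rule sum.reindex_bij_betw[OF site_bij[OF assms(1)]])
  also have "\<dots> = 0"
    using site_bij[OF assms(1), of d] assms(2)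
    by (intro torus_laplacian_row_sum) (auto simp: bij_betw_def)
  finally show ?thesis .
qed

text \<open>The quadratic form of the Laplacian is the negative Dirichlet form, since the rows sum to zero.\<close>

lemma laplacian_dirichlet_form:
  fixes x :: "nat \<Rightarrow> complex" and L d :: nat
  assumes "L \<ge> 1"
  defines "n \<equiv> L ^ d" and "A \<equiv> \<lambda>i j. complex_of_real (laplacian L d $$ (i, j))"
  shows "(\<Sum>i<n. \<Sum>j<n. cnj (x i) * A i j * x j)
    = complex_of_real (- (\<Sum>i<n. \<Sum>j<n. laplacian L d $$ (i, j) * (cmod (x i - x j))\<^sup>2) / 2)"
proof -
  define X where "X = (\<Sum>i<n. \<Sum>j<n. cnj (x i) * A i j * x j)"
  have sym: "A i j = A j i" if "i < n" "j < n" for i j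
    using laplacian_sym[of i L d j] that by (simp add: A_def n_def)
  have row: "(\<Sum>j<n. A i j) = 0" if "i < n" for i
  proof -
    have "(\<Sum>j<n. A i j) = complex_of_real (\<Sum>j<n. laplacian L d $$ (i, j))"
      by (simp add: A_def)
    also have "(\<Sum>j<n. laplacian L d $$ (i, j)) = 0"
      using laplacian_row_sum[OF assms(1), of i d] that by (simp add: n_def)
    finally show ?thesis by simp
  qed
  have X': "X = (\<Sum>i<n. \<Sum>j<n. x i * A i j * cnj (x j))"
    unfolding X_def by (subst sum.swap) (auto intro!: sum.cong simp: sym mult_ac)
  have z1: "(\<Sum>i<n. \<Sum>j<n. A i j * (x i * cnj (x i))) = 0"
    by (auto simp: sum_distrib_right[symmetric] row)
  have z2: "(\<Sum>i<n. \<Sum>j<n. A i j * (x j * cnj (x j))) = 0"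
  proof -
    have "(\<Sum>i<n. \<Sum>j<n. A i j * (x j * cnj (x j))) = (\<Sum>j<n. \<Sum>i<n. A j i * (x j * cnj (x j)))"
      by (subst sum.swap) (auto intro!: sum.cong simp: sym)
    then show ?thesis using z1 by simp
  qed
  have "complex_of_real (\<Sum>i<n. \<Sum>j<n. laplacian L d $$ (i, j) * (cmod (x i - x j))\<^sup>2)
      = (\<Sum>i<n. \<Sum>j<n. A i j * ((x i - x j) * cnj (x i - x j)))"
    by (simp add: A_def complex_norm_square del: of_real_power)
  also have "\<dots> = (\<Sum>i<n. \<Sum>j<n. A i j * (x i * cnj (x i)) + A i j * (x j * cnj (x j))
      - cnj (x i) * A i j * x j - x i * A i j * cnj (x j))"
    by (intro sum.cong) (auto simp: algebra_simps)
  also have "\<dots> = - 2 * X"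
    unfolding sum_subtractf sum.distrib z1 z2 X_def[symmetric] X'[symmetric] by simp
  finally show ?thesis by (simp add: X_def)
qed

text \<open>Testing the eigenvalue equation against the conjugate eigenvector gives e |v|^2 = - D /
  2 with D the Dirichlet form, so reality and sign of e come out together. D is nonnegative since
  the off-diagonal entries are and the diagonal terms vanish.\<close>

lemma laplacian_eigenvalue_nonpos:
  assumes L: "L \<ge> 1" and ev: "eigenvalue (map_mat complex_of_real (laplacian L d)) e"
  shows "\<exists>a\<ge>0. e = - complex_of_real a"
proof -
  define n where "n = L ^ d"
  let ?A = "map_mat complex_of_real (laplacian L d)"
  have A: "?A \<in> carrier_mat n n" by (simp add: n_def)
  obtain v where v: "v \<in> carrier_vec n" "v \<noteq> 0\<^sub>v n" "?A *\<^sub>v v = e \<cdot>\<^sub>v v"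
    using ev A by (auto simp: eigenvalue_def eigenvector_def)
  define x where "x i = v $ i" for i
  have eq: "(\<Sum>j<n. complex_of_real (laplacian L d $$ (i, j)) * x j) = e * x i" if "i < n" for i
  proof -
    have "(?A *\<^sub>v v) $ i = (\<Sum>j<n. complex_of_real (laplacian L d $$ (i, j)) * x j)"
      using that A v(1) by (auto simp: scalar_prod_def atLeast0LessThan x_def)
    then show ?thesis using v that by (simp add: x_def)
  qed
  define N where "N = (\<Sum>i<n. (cmod (x i))\<^sup>2)"
  obtain i0 where i0: "i0 < n" "x i0 \<noteq> 0"
    using v(1,2) by (auto simp: x_def vec_eq_iff)
  have "0 < (cmod (x i0))\<^sup>2" using i0 by simp
  also have "\<dots> \<le> N" unfolding N_def
    by (rule member_le_sum) (use i0 in auto)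
  finally have N: "N > 0" .
  define D where "D = (\<Sum>i<n. \<Sum>j<n. laplacian L d $$ (i, j) * (cmod (x i - x j))\<^sup>2)"
  have "laplacian L d $$ (i, j) * (cmod (x i - x j))\<^sup>2 \<ge> 0" if "i < n" "j < n" for i j
    using laplacian_offdiag_nonneg[OF L, of i d j] that by (cases "i = j") (auto simp: n_def)
  then have D: "D \<ge> 0" unfolding D_def by (intro sum_nonneg) auto
  have "complex_of_real (- D / 2) = (\<Sum>i<n. \<Sum>j<n. cnj (x i) * complex_of_real (laplacian L d $$ (i, j)) * x j)"
    using laplacian_dirichlet_form[OF L, of x d] by (simp add: D_def n_def)
  also have "\<dots> = (\<Sum>i<n. cnj (x i) * (e * x i))"
    by (intro sum.cong) (auto simp: eq[symmetric] sum_distrib_left mult_ac)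
  also have "\<dots> = e * complex_of_real N"
    by (simp add: N_def sum_distrib_left complex_norm_square mult_ac del: of_real_power)
  finally have "e = - complex_of_real (D / 2 / N)"
    using N by (simp add: field_simps)
  moreover have "D / 2 / N \<ge> 0" using D N by simp
  ultimately show ?thesis by blast
qed

text \<open>The constant vector is the eigenvector. This eigenvalue provides the lower bound in
  \<open>R_one_bounds\<close>, and with it the surjectivity of R_1.\<close>

lemma laplacian_eigenvalue_zero:
  assumes L: "L \<ge> 1"
  shows "eigenvalue (map_mat complex_of_real (laplacian L d)) 0"
proof -
  define n where "n = L ^ d"
  let ?A = "map_mat complex_of_real (laplacian L d)"
  have A: "?A \<in> carrier_mat n n" by (simp add: n_def)
  define v :: "complex vec" where "v = vec n (\<lambda>_. 1)"
  have "?A *\<^sub>v v = 0 \<cdot>\<^sub>v v"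
  proof (rule eq_vecI)
    fix i assume "i < dim_vec (0 \<cdot>\<^sub>v v)"
    then have i: "i < n" by (simp add: v_def)
    have "(?A *\<^sub>v v) $ i = complex_of_real (\<Sum>j<n. laplacian L d $$ (i, j))"
      using i A by (simp add: scalar_prod_def atLeast0LessThan v_def n_def row_def)
    also have "(\<Sum>j<n. laplacian L d $$ (i, j)) = 0"
      using laplacian_row_sum[OF L, of i d] i by (simp add: n_def)
    finally show "(?A *\<^sub>v v) $ i = (0 \<cdot>\<^sub>v v) $ i"
      using i by (simp add: v_def)
  qed (use A in \<open>simp add: v_def n_def\<close>)
  moreover have "v \<noteq> 0\<^sub>v n" using L by (auto simp: v_def vec_eq_iff n_def intro!: exI[of _ 0])
  ultimately show ?thesis using A
    by (auto simp: eigenvalue_def eigenvector_def v_def n_def intro!: exI[of _ v])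
qed

text \<open>The numbers \<open>a i\<close> are the eigenvalues of - t Delta with multiplicity. One
  change of basis triangularises the shifted matrix for every u, so a single family serves all u and
  k, and calculus in u becomes calculus of finite sums.\<close>

lemma shifted_spectrum:
  assumes L: "L \<ge> 1" and t: "t > 0"
  obtains a :: "nat \<Rightarrow> real" where "\<And>i. a i \<ge> 0" "\<exists>i<L ^ d. a i = 0"
    "\<And>u. u > 0 \<Longrightarrow> Determinant.det (shifted L d t u) = (\<Prod>i<L ^ d. u + a i)"
    "\<And>k u. u > 0 \<Longrightarrow> R L d t k u = (\<Sum>i<L ^ d. (1 / (u + a i)) ^ k) / real (L ^ d)"
proof -
  define n where "n = L ^ d"
  define A where "A = map_mat complex_of_real (laplacian L d)"
  have A: "A \<in> carrier_mat n n" by (simp add: A_def n_def)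
  obtain T P Q where T: "similar_mat_wit A T P Q" "upper_triangular T" "T \<in> carrier_mat n n"
    and ev: "\<And>e. eigenvalue A e \<longleftrightarrow> (\<exists>i<n. e = T $$ (i, i))"
    using complex_triangularisation[OF A] by blast
  have car: "P \<in> carrier_mat n n" "Q \<in> carrier_mat n n"
    and PQ: "P * Q = 1\<^sub>m n" and QP: "Q * P = 1\<^sub>m n" and APTQ: "A = P * T * Q"
    using similar_mat_witD2[OF A T(1)] by auto
  have "\<forall>i. \<exists>a\<ge>0. i < n \<longrightarrow> T $$ (i, i) = - complex_of_real a"
    using laplacian_eigenvalue_nonpos[OF L] ev unfolding A_def by (metis order_refl)
  then obtain b :: "nat \<Rightarrow> real" where b: "\<And>i. b i \<ge> 0"
    "\<And>i. i < n \<Longrightarrow> T $$ (i, i) = - complex_of_real (b i)" by metis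
  define a where "a i = t * b i" for i
  have a0: "a i \<ge> 0" for i using b t by (simp add: a_def)
  have "\<exists>i<n. T $$ (i, i) = 0"
    using laplacian_eigenvalue_zero[OF L, of d] ev[of 0] unfolding A_def by metis
  then have az: "\<exists>i<n. a i = 0" using b by (auto simp: a_def)
  have main: "Determinant.det (shifted L d t u) = (\<Prod>i<n. u + a i) \<and>
      R L d t k u = (\<Sum>i<n. (1 / (u + a i)) ^ k) / real n" if u: "u > 0" for u k
  proof -
    define S where "S = shifted L d t u"
    have S: "S \<in> carrier_mat n n" by (auto simp: S_def shifted_def n_def intro!: minus_carrier_mat)
    define CS where "CS = map_mat complex_of_real S"
    have CS: "CS \<in> carrier_mat n n" using S by (simp add: CS_def)
    define U where "U = mat n n (\<lambda>(i, j). (if i = j then complex_of_real u else 0)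
       - complex_of_real t * T $$ (i, j))"
    have U: "U \<in> carrier_mat n n" by (simp add: U_def)
    have utU: "upper_triangular U"
      using T(2,3) by (auto simp: U_def upper_triangularD intro!: upper_triangularI)
    have Udiag: "U $$ (i, i) = complex_of_real (u + a i)" if "i < n" for i
      using that b(2)[OF that] by (simp add: U_def a_def)
    have U_alt: "U = complex_of_real u \<cdot>\<^sub>m 1\<^sub>m n - complex_of_real t \<cdot>\<^sub>m T"
      using T(3) by (intro eq_matI) (auto simp: U_def)
    have "CS = complex_of_real u \<cdot>\<^sub>m 1\<^sub>m n - complex_of_real t \<cdot>\<^sub>m A"
      by (intro eq_matI) (auto simp: CS_def S_def shifted_def A_def n_def laplacian_def)
    also have "\<dots> = P * U * Q"
    proof -
      have "P * U = complex_of_real u \<cdot>\<^sub>m P - complex_of_real t \<cdot>\<^sub>m (P * T)"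
        unfolding U_alt using car T(3)
        by (subst mult_minus_distrib_mat[of _ n n _ n])
          (auto simp: mult_smult_distrib[of _ n n _ n])
      also have "\<dots> * Q = complex_of_real u \<cdot>\<^sub>m (P * Q) - complex_of_real t \<cdot>\<^sub>m (P * T * Q)"
        using car T(3)
        by (subst minus_mult_distrib_mat[of _ n n _ _ n])
          (auto simp: mult_smult_assoc_mat[of _ n n _ n])
      finally show ?thesis using PQ APTQ by simp
    qed
    finally have CSU: "CS = P * U * Q" .
    have "Determinant.det CS = Determinant.det U"
      using CSU CS U car PQ QP by (intro det_similar similar_matI[of _ _ P Q n]) auto
    also have "\<dots> = (\<Prod>i<n. complex_of_real (u + a i))"
      using U utU by (simp add: det_upper_triangular prod_list_diag_prod Udiag atLeast0LessThan
          del: of_real_add)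
    finally have "complex_of_real (Determinant.det S) = complex_of_real (\<Prod>i<n. u + a i)"
      by (simp add: CS_def of_real_hom.hom_det)
    then have detS: "Determinant.det S = (\<Prod>i<n. u + a i)"
      unfolding of_real_eq_iff .
    have pos: "u + a i > 0" for i using u a0[of i] by simp
    \<comment> \<open>\<open>R\<close> is defined by \<open>the (mat_inverse ...)\<close>, so
      invertibility has to be known before the resolvent can be named.\<close>
    have "Determinant.det S \<noteq> 0" unfolding detS using pos by (simp add: less_imp_neq[symmetric])
    then have "S \<in> Units (ring_mat TYPE(real) n ())"
      using S by (rule det_non_zero_imp_unit[rotated])
    then obtain M where M: "mat_inverse S = Some M"
      using mat_inverse(1)[OF S, where b = "()"] by fastforce
    have SM: "S * M = 1\<^sub>m n" and Mc: "M \<in> carrier_mat n n"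
      using mat_inverse(2)[OF S M] by auto
    define CM where "CM = map_mat complex_of_real M"
    have CM: "CM \<in> carrier_mat n n" using Mc by (simp add: CM_def)
    have CSM: "CS * CM = 1\<^sub>m n"
      using arg_cong[OF SM, of "map_mat complex_of_real"] S Mc
      by (simp add: CS_def CM_def of_real_hom.mat_hom_mult[of _ n n _ n] of_real_hom.mat_hom_one)
    \<comment> \<open>The inverse seen in the triangularising basis: \<open>U * N = 1\<close> below
      makes it triangular with diagonal 1 / (u + a i).\<close>
    define N where "N = Q * CM * P"
    have N: "N \<in> carrier_mat n n" using car CM by (simp add: N_def)
    have PN: "P * N = CM * P"
    proof -
      have "P * N = P * (Q * (CM * P))"
        using car CM by (simp add: N_def assoc_mult_mat[of Q n n CM n P n])
      also have "\<dots> = P * Q * (CM * P)"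
        using car CM by (intro assoc_mult_mat[symmetric, of _ n n _ n _ n]) auto
      finally show ?thesis using car CM PQ by simp
    qed
    have simM: "CM = P * N * Q"
      using car CM PQ unfolding PN by (simp add: assoc_mult_mat[of CM n n P n Q n])
    have "U * N = Q * P * U * N"
      using QP U N by simp
    also have "\<dots> = Q * (P * U * Q) * (P * N)"
    proof -
      have "Q * (P * U * Q) * (P * N) = Q * (P * U * Q) * P * N"
        using car U N by (intro assoc_mult_mat[symmetric, of _ n n _ n _ n]) auto
      also have "Q * (P * U * Q) * P = Q * (P * U * Q * P)"
        using car U by (intro assoc_mult_mat[of _ n n _ n _ n]) auto
      also have "P * U * Q * P = P * U * (Q * P)"
        using car U by (intro assoc_mult_mat[of _ n n _ n _ n]) auto
      also have "\<dots> = P * U" using car U QP by simp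
      also have "Q * (P * U) = Q * P * U"
        using car U by (intro assoc_mult_mat[symmetric, of _ n n _ n _ n]) auto
      finally show ?thesis by simp
    qed
    also have "\<dots> = Q * CS * (CM * P)" using PN CSU by simp
    also have "\<dots> = Q * CS * CM * P"
      using car CS CM by (intro assoc_mult_mat[symmetric, of _ n n _ n _ n]) auto
    also have "Q * CS * CM = Q * (CS * CM)"
      using car CS CM by (intro assoc_mult_mat[of _ n n _ n _ n]) auto
    also have "Q * (CS * CM) * P = 1\<^sub>m n" using CSM car QP by simp
    finally have UN: "U * N = 1\<^sub>m n" .
    have nz: "U $$ (i, i) \<noteq> 0" if "i < n" for i
      using Udiag[OF that] pos[of i] by (simp del: of_real_add)
    note inv = upper_triangular_inverse[OF U N utU nz UN]
    have wit: "similar_mat_wit CM N P Q"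
      using CM N car PQ QP simM by (auto simp: similar_mat_wit_def Let_def)
    have Mk: "M ^\<^sub>m k \<in> carrier_mat n n" using Mc by simp
    have "complex_of_real (\<Sum>i<n. (M ^\<^sub>m k) $$ (i, i)) = (\<Sum>i<n. (CM ^\<^sub>m k) $$ (i, i))"
      using carrier_matD[OF Mk] by (simp add: CM_def of_real_hom.mat_hom_pow[OF Mc, symmetric])
    also have "\<dots> = (\<Sum>i<n. (N ^\<^sub>m k) $$ (i, i))"
      using similar_mat_wit_pow[OF wit] CM by (intro diag_sum_similar[where P=P and Q=Q]) auto
    also have "\<dots> = (\<Sum>i<n. complex_of_real ((1 / (u + a i)) ^ k))"
      using upper_triangular_pow[OF N inv(1), of k] inv(2) Udiag by (intro sum.cong) auto
    also have "\<dots> = complex_of_real (\<Sum>i<n. (1 / (u + a i)) ^ k)" by simp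
    finally have "(\<Sum>i<n. (M ^\<^sub>m k) $$ (i, i)) = (\<Sum>i<n. (1 / (u + a i)) ^ k)"
      unfolding of_real_eq_iff .
    moreover have "R L d t k u = (\<Sum>i<n. (M ^\<^sub>m k) $$ (i, i)) / real n"
      unfolding R_def S_def[symmetric] M ntrace_def using Mc by simp
    ultimately show ?thesis using detS by (simp add: S_def)
  qed
  show thesis
  proof (rule that[of a])
    show "\<exists>i<L ^ d. a i = 0" using az by (simp add: n_def)
  qed (use a0 main in \<open>auto simp: n_def\<close>)
qed

section \<open>The function K\<close>

locale resolvent =
  fixes L d :: nat and t :: real
  assumes L: "L \<ge> 1" and t: "t > 0"
begin

section \<open>Derivatives, monotonicity and range of the resolvent traces\<close>

lemma R_has_derivative:
  assumes "u > 0"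
  shows "(R L d t 1 has_real_derivative - R L d t 2 u) (at u)"
proof -
  obtain a where a: "\<And>i. a i \<ge> 0"
    "\<And>k u. u > 0 \<Longrightarrow> R L d t k u = (\<Sum>i<L ^ d. (1 / (u + a i)) ^ k) / real (L ^ d)"
    using shifted_spectrum[OF L t] by metis
  have nz: "u + a i \<noteq> 0" for i using a(1)[of i] assms by linarith
  have "((\<lambda>u. (\<Sum>i<L ^ d. (1 / (u + a i)) ^ 1) / real (L ^ d)) has_real_derivative
      (\<Sum>i<L ^ d. - ((1 / (u + a i)) ^ 2)) / real (L ^ d)) (at u)"
    using nz L by (auto intro!: derivative_eq_intros simp: power2_eq_square)
  then have "(R L d t 1 has_real_derivative
      (\<Sum>i<L ^ d. - ((1 / (u + a i)) ^ 2)) / real (L ^ d)) (at u)"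
    by (rule has_field_derivative_transform_within_open[where S = "{0<..}"]) (use assms a(2) in auto)
  moreover have "(\<Sum>i<L ^ d. - ((1 / (u + a i)) ^ 2)) / real (L ^ d) = - R L d t 2 u"
    using a(2)[OF assms] by (simp add: sum_negf)
  ultimately show ?thesis by simp
qed

lemma R_two_pos: "u > 0 \<Longrightarrow> R L d t 2 u > 0"
  and R_two_strict_anti: "0 < u \<Longrightarrow> u < v \<Longrightarrow> R L d t 2 v < R L d t 2 u"
  and isCont_R_two: "u > 0 \<Longrightarrow> isCont (R L d t 2) u"
proof -
  obtain a where a: "\<And>i. a i \<ge> 0"
    "\<And>k u. u > 0 \<Longrightarrow> R L d t k u = (\<Sum>i<L ^ d. (1 / (u + a i)) ^ k) / real (L ^ d)"
    using shifted_spectrum[OF L t] by metis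
  have pos: "u + a i > 0" if "u > 0" for u i using a(1)[of i] that by linarith
  have n: "{..<L ^ d} \<noteq> {}" "0 < real (L ^ d)" using L by (auto simp: lessThan_empty_iff)
  show "R L d t 2 u > 0" if "u > 0"
    unfolding a(2)[OF that] using n
    by (intro divide_pos_pos sum_pos zero_less_power divide_pos_pos pos[OF that]) auto
  show "R L d t 2 v < R L d t 2 u" if "0 < u" "u < v"
  proof -
    have "v > 0" using that by simp
    have "(1 / (v + a i)) ^ 2 < (1 / (u + a i)) ^ 2" for i
      using pos[OF that(1), of i] that pos[OF \<open>v > 0\<close>, of i]
      by (intro power_strict_mono divide_strict_left_mono) auto
    then have "(\<Sum>i<L ^ d. (1 / (v + a i)) ^ 2) < (\<Sum>i<L ^ d. (1 / (u + a i)) ^ 2)"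
      using n by (intro sum_strict_mono) auto
    then show ?thesis
      unfolding a(2)[OF that(1)] a(2)[OF \<open>v > 0\<close>] using n by (intro divide_strict_right_mono)
  qed
  show "isCont (R L d t 2) u" if "u > 0"
  proof -
    have nz: "u + a i \<noteq> 0" if "u > 0" for u i using pos[OF that, of i] by simp
    have "continuous_on {0<..} (\<lambda>u. (\<Sum>i<L ^ d. (1 / (u + a i)) ^ 2) / real (L ^ d))"
      using nz L by (intro continuous_intros) auto
    then have "continuous_on {0<..} (R L d t 2)"
      by (rule continuous_on_eq) (use a(2) in auto)
    then show ?thesis using that by (simp add: continuous_on_eq_continuous_at)
  qed
qed

text \<open>Jacobi's formula, here the derivative of a sum of logarithms; the factor L^d undoes the
  normalisation of the trace.\<close>

lemma logdet_has_derivative: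
  assumes "u > 0"
  shows "(logdet L d t has_real_derivative real (L ^ d) * R L d t 1 u) (at u)"
proof -
  obtain a where a: "\<And>i. a i \<ge> 0"
    "\<And>u. u > 0 \<Longrightarrow> Determinant.det (shifted L d t u) = (\<Prod>i<L ^ d. u + a i)"
    "\<And>k u. u > 0 \<Longrightarrow> R L d t k u = (\<Sum>i<L ^ d. (1 / (u + a i)) ^ k) / real (L ^ d)"
    using shifted_spectrum[OF L t] by metis
  have pos: "u + a i > 0" if "u > 0" for u i using a(1)[of i] that by linarith
  have eq: "logdet L d t u = (\<Sum>i<L ^ d. ln (u + a i))" if "u > 0" for u
    unfolding logdet_def a(2)[OF that] using pos[OF that, THEN less_imp_neq, THEN not_sym] by (intro ln_prod) auto
  have nz: "u + a i \<noteq> 0" for i using pos[OF assms, of i] by simp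
  have "((\<lambda>u. \<Sum>i<L ^ d. ln (u + a i)) has_real_derivative (\<Sum>i<L ^ d. 1 / (u + a i))) (at u)"
    using pos[OF assms] nz by (auto intro!: derivative_eq_intros)
  then have "(logdet L d t has_real_derivative (\<Sum>i<L ^ d. 1 / (u + a i))) (at u)"
    by (rule has_field_derivative_transform_within_open[where S = "{0<..}"]) (use assms eq in auto)
  moreover have "(\<Sum>i<L ^ d. 1 / (u + a i)) = real (L ^ d) * R L d t 1 u"
    using a(3)[OF assms, of 1] L by simp
  ultimately show ?thesis by simp
qed

lemma R_one_strict_anti:
  assumes "0 < u" "u < v"
  shows "R L d t 1 v < R L d t 1 u"
proof (rule DERIV_neg_imp_decreasing[OF assms(2)])
  fix x assume "u \<le> x" "x \<le> v"
  then have "x > 0" using assms by simp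
  then show "\<exists>y. (R L d t 1 has_real_derivative y) (at x) \<and> y < 0"
    using R_has_derivative[of x] R_two_pos[of x] by (intro exI[of _ "- R L d t 2 x"]) auto
qed

text \<open>The lower bound keeps only the eigenvalue 0, the upper bound replaces every a_i by 0. At
  u = 1 / (L^d s) and u = 1 / s they bracket the value s, which starts the intermediate value
  argument in \<open>R_one_bij\<close>.\<close>

lemma R_one_bounds:
  assumes "u > 0"
  shows "1 / (real (L ^ d) * u) \<le> R L d t 1 u" "R L d t 1 u \<le> 1 / u"
proof -
  obtain a i0 where a: "\<And>i. a i \<ge> 0" "i0 < L ^ d" "a i0 = 0"
    "\<And>k u. u > 0 \<Longrightarrow> R L d t k u = (\<Sum>i<L ^ d. (1 / (u + a i)) ^ k) / real (L ^ d)"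
    using shifted_spectrum[OF L t] by metis
  have pos: "u + a i > 0" for i using a(1)[of i] assms by linarith
  have n: "0 < real (L ^ d)" using L by simp
  have "1 / (u + a i0) \<le> (\<Sum>i<L ^ d. 1 / (u + a i))"
    by (rule member_le_sum) (use a(2) pos[THEN less_imp_le] in auto)
  then have "1 / u / real (L ^ d) \<le> R L d t 1 u"
    unfolding a(4)[OF assms] using n a(3) by (intro divide_right_mono) auto
  then show "1 / (real (L ^ d) * u) \<le> R L d t 1 u" by (simp add: mult.commute)
  have "(\<Sum>i<L ^ d. 1 / (u + a i)) \<le> (\<Sum>i<L ^ d. 1 / u)"
    using assms a(1) pos by (intro sum_mono divide_left_mono) auto
  also have "\<dots> = real (L ^ d) * (1 / u)" by simp
  finally show "R L d t 1 u \<le> 1 / u"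
    unfolding a(4)[OF assms] using n by (simp add: pos_divide_le_eq mult.commute)
qed

lemma R_one_pos:
  assumes "u > 0" shows "R L d t 1 u > 0"
proof -
  have "0 < 1 / (real (L ^ d) * u)" using assms L by simp
  then show ?thesis using R_one_bounds(1)[OF assms] by linarith
qed

lemma R_one_bij: "bij_betw (R L d t 1) {0<..} {0<..}"
  unfolding bij_betw_def
proof
  show inj: "inj_on (R L d t 1) {0<..}"
    by (rule linorder_inj_onI') (use R_one_strict_anti in fastforce)
  show "R L d t 1 ` {0<..} = {0<..}"
  proof (intro equalityI subsetI)
    fix s :: real assume "s \<in> {0<..}"
    then have s: "s > 0" by simp
    define n where "n = real (L ^ d)"
    have n: "n \<ge> 1" using L by (simp add: n_def)
    have le: "1 / (n * s) \<le> 1 / s" using n s by (intro divide_left_mono) auto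
    have pos: "1 / (n * s) > 0" using n s by simp
    have "s \<le> R L d t 1 (1 / (n * s))"
      using R_one_bounds(1)[OF pos] n s unfolding n_def[symmetric] by (simp add: field_simps)
    moreover have "R L d t 1 (1 / s) \<le> s"
      using R_one_bounds(2)[of "1 / s"] s by simp
    moreover have "\<forall>x. 1 / (n * s) \<le> x \<and> x \<le> 1 / s \<longrightarrow> isCont (R L d t 1) x"
      using pos by (intro allI impI DERIV_isCont[OF R_has_derivative]) linarith
    ultimately have "\<exists>u. 1 / (n * s) \<le> u \<and> u \<le> 1 / s \<and> R L d t 1 u = s"
      using le by (intro IVT2) auto
    then obtain u where "1 / (n * s) \<le> u" "R L d t 1 u = s" by blast
    then show "s \<in> R L d t 1 ` {0<..}"
      using less_le_trans[OF pos] by (intro image_eqI[of _ _ u]) auto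
  qed (use R_one_pos in auto)
qed

section \<open>The inverse K of R_1 and its derivative\<close>

lemma K_pos: "s > 0 \<Longrightarrow> K L d t s > 0"
  and R_K: "s > 0 \<Longrightarrow> R L d t 1 (K L d t s) = s"
  and K_R: "u > 0 \<Longrightarrow> K L d t (R L d t 1 u) = u"
  using R_one_bij bij_betw_the_inv_into[OF R_one_bij]
  by (auto simp: K_def bij_betw_def f_the_inv_into_f the_inv_into_f_f)

lemma K_strict_anti:
  assumes "0 < s" "s < s'"
  shows "K L d t s' < K L d t s"
proof (rule ccontr)
  assume "\<not> ?thesis"
  then have "K L d t s \<le> K L d t s'" by simp
  then have "R L d t 1 (K L d t s') \<le> R L d t 1 (K L d t s)"
    using R_one_strict_anti[of "K L d t s" "K L d t s'"] K_pos[of s] assms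
    by (cases "K L d t s = K L d t s'") auto
  then show False using R_K assms by simp
qed

lemma K_has_derivative:
  assumes "s > 0"
  shows "(K L d t has_real_derivative - 1 / R L d t 2 (K L d t s)) (at s)"
proof -
  define u where "u = K L d t s"
  have u: "u > 0" "R L d t 1 u = s" using K_pos R_K assms by (auto simp: u_def)
  have "(K L d t has_derivative (*) (- 1 / R L d t 2 u)) (at (R L d t 1 u))"
  proof (rule has_derivative_inverse_strong[where S = "{0<..}" and x = u and f' = "(*) (- R L d t 2 u)"])
    show "open {0::real<..}" by simp
    show "u \<in> {0<..}" using u by simp
    show "K L d t (R L d t 1 x) = x" if "x \<in> {0<..}" for x using K_R that by simp
    show "(*) (- R L d t 2 u) \<circ> (*) (- 1 / R L d t 2 u) = id"
      using R_two_pos[OF u(1)] by (simp add: fun_eq_iff)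
    show "continuous_on {0<..} (R L d t 1)"
      by (intro continuous_at_imp_continuous_on ballI DERIV_isCont[OF R_has_derivative]) auto
    show "(R L d t 1 has_derivative (*) (- R L d t 2 u)) (at u)"
      using R_has_derivative[OF u(1)] by (simp add: has_field_derivative_def)
  qed
  then show ?thesis using u by (simp add: has_field_derivative_def u_def)
qed

lemma deriv_K: "s > 0 \<Longrightarrow> deriv (K L d t) s = - 1 / R L d t 2 (K L d t s)"
  by (rule DERIV_imp_deriv[OF K_has_derivative])

lemma K_has_deriv: "s > 0 \<Longrightarrow> (K L d t has_real_derivative deriv (K L d t) s) (at s)"
  using K_has_derivative deriv_K by simp

text \<open>K' = - 1 / (R_2 o K), and R_2 o K increases because both factors decrease. Strictness is
  what later separates a spread measure from a Dirac mass.\<close>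

lemma deriv_K_strict_mono:
  assumes "0 < s" "s < s'"
  shows "deriv (K L d t) s < deriv (K L d t) s'"
proof -
  have "R L d t 2 (K L d t s) < R L d t 2 (K L d t s')"
    using assms by (intro R_two_strict_anti K_strict_anti K_pos) auto
  moreover have "R L d t 2 (K L d t s) > 0" using R_two_pos K_pos assms by simp
  ultimately show ?thesis using assms by (simp add: deriv_K frac_less2)
qed

lemma deriv_K_mono: "0 < s \<Longrightarrow> s \<le> s' \<Longrightarrow> deriv (K L d t) s \<le> deriv (K L d t) s'"
  using deriv_K_strict_mono[of s s'] by (cases "s = s'") auto

lemma continuous_on_deriv_K: "continuous_on {0<..} (deriv (K L d t))"
proof -
  have "continuous_on {0<..} (\<lambda>s. - 1 / R L d t 2 (K L d t s))"
  proof (intro continuous_at_imp_continuous_on ballI continuous_intros)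
    fix s :: real assume "s \<in> {0<..}"
    then have s: "s > 0" by simp
    show "isCont (\<lambda>s. R L d t 2 (K L d t s)) s"
      using isCont_o2[OF DERIV_isCont[OF K_has_derivative[OF s]] isCont_R_two[OF K_pos[OF s]]] .
    show "R L d t 2 (K L d t s) \<noteq> 0" using R_two_pos[OF K_pos[OF s]] by simp
  qed
  then show ?thesis by (rule continuous_on_eq) (simp add: deriv_K)
qed

text \<open>The Legendre-type cancellation \<open>s K'(s) = R\<^sub>1(K(s)) K'(s)\<close>.\<close>

lemma K_primitive:
  assumes "s > 0"
  shows "((\<lambda>s. s * K L d t s - 1 / real (L ^ d) * logdet L d t (K L d t s))
    has_real_derivative K L d t s) (at s)"
proof -
  define n where "n = real (L ^ d)"
  have n: "n > 0" using L by (simp add: n_def)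
  have "((\<lambda>s. logdet L d t (K L d t s)) has_real_derivative
      n * R L d t 1 (K L d t s) * deriv (K L d t) s) (at s)"
    unfolding n_def by (rule DERIV_chain2[OF logdet_has_derivative[OF K_pos[OF assms]] K_has_deriv[OF assms]])
  then show ?thesis
    unfolding n_def[symmetric] using n R_K[OF assms]
    by (auto intro!: derivative_eq_intros K_has_deriv[OF assms])
qed

end

section \<open>The covariance function\<close>

text \<open>A second-order remainder valid for all w, to be applied under the integral defining
  \<open>B\<close>. Both one-sided estimates follow from 1 + x <= exp x at x = w and x = -w.\<close>

lemma abs_exp_minus_one_minus_le: "\<bar>exp w - 1 - w\<bar> \<le> w\<^sup>2 * exp \<bar>w\<bar>" for w :: real
proof -
  have lower: "exp w - 1 - w \<ge> 0" using exp_ge_add_one_self[of w] by linarith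
  have "1 - w \<le> exp (- w)" using exp_ge_add_one_self[of "- w"] by simp
  then have "(1 - w) * exp w \<le> exp (- w) * exp w" by (intro mult_right_mono) auto
  then have up: "exp w - 1 \<le> w * exp w" by (simp add: exp_minus algebra_simps)
  have "exp w - 1 - w \<le> w\<^sup>2 * exp \<bar>w\<bar>"
  proof (cases "w \<ge> 0")
    case True
    have "w * (exp w - 1) \<le> w * (w * exp w)" using True up by (intro mult_left_mono) auto
    then show ?thesis using up True by (simp add: power2_eq_square algebra_simps)
  next
    case False
    have "(- w) * (1 - exp w) \<le> (- w) * (- w)"
      using False lower by (intro mult_left_mono) auto
    moreover have "w\<^sup>2 * 1 \<le> w\<^sup>2 * exp \<bar>w\<bar>" by (intro mult_left_mono) auto
    ultimately show ?thesis using up by (simp add: power2_eq_square algebra_simps)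
  qed
  with lower show ?thesis by simp
qed

text \<open>A single term of the exponential series; it lets an exponential moment dominate every
  power.\<close>

lemma power_le_fact_exp:
  fixes z :: real
  assumes "z \<ge> 0"
  shows "z ^ k \<le> fact k * exp z"
proof -
  have sums: "(\<lambda>n. z ^ n / fact n) sums exp z"
    using exp_converges[of z] by (simp add: field_simps)
  have "z ^ k / fact k \<le> exp z"
    using sum_le_suminf[OF sums_summable[OF sums], of "{k}"] sums_unique[OF sums] assms by simp
  then show ?thesis by (simp add: field_simps)
qed

text \<open>Differentiation under the integral is reduced to an explicit quadratic error, which can
  be integrated directly.\<close>

lemma DERIV_quadratic_remainder:
  fixes f :: "real \<Rightarrow> real"
  assumes "\<delta> > 0" and rem: "\<And>h. \<bar>h\<bar> < \<delta> \<Longrightarrow> \<bar>f (x + h) - f x - h * D\<bar> \<le> M * h\<^sup>2"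
  shows "(f has_real_derivative D) (at x)"
proof -
  have "((\<lambda>h. (f (x + h) - f x) / h - D) \<longlongrightarrow> 0) (at 0)"
  proof (rule Lim_null_comparison)
    show "((\<lambda>h. M * \<bar>h\<bar>) \<longlongrightarrow> 0) (at 0)" by (auto intro!: tendsto_eq_intros)
    have "norm ((f (x + h) - f x) / h - D) \<le> M * \<bar>h\<bar>" if "h \<noteq> 0" "\<bar>h\<bar> < \<delta>" for h
    proof -
      have "(f (x + h) - f x) / h - D = (f (x + h) - f x - h * D) / h"
        using that by (simp add: diff_divide_distrib)
      then have "norm ((f (x + h) - f x) / h - D) = \<bar>f (x + h) - f x - h * D\<bar> / \<bar>h\<bar>"
        by (simp add: abs_divide)
      also have "\<dots> \<le> M * h\<^sup>2 / \<bar>h\<bar>" using rem[OF that(2)] by (intro divide_right_mono) auto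
      also have "\<dots> = M * \<bar>h\<bar>"
        using that by (cases "h > 0") (auto simp: power2_eq_square)
      finally show ?thesis .
    qed
    then show "\<forall>\<^sub>F h in at 0. norm ((f (x + h) - f x) / h - D) \<le> M * \<bar>h\<bar>"
      using assms(1) by (auto simp: eventually_at intro!: exI[of _ \<delta>])
  qed
  then show ?thesis unfolding DERIV_def by (simp add: LIM_zero_iff)
qed

section \<open>Moments of the spectral measure and the derivatives of B\<close>

locale covariance =
  fixes \<nu> :: "real measure"
  assumes spectral: "spectral_measure \<nu>"
begin

text \<open>Up to the sign (-1)^k this is the k-th derivative of \<open>B\<close>:
  \<open>moment 1\<close> is -B' and \<open>moment 2\<close> is B''.\<close>

definition moment :: "nat \<Rightarrow> real \<Rightarrow> real" where
  "moment k x = (\<integral>y. (y\<^sup>2) ^ k * exp (- y\<^sup>2 * x) \<partial>\<nu>)"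

lemma sets_borel [measurable_cong]: "sets \<nu> = sets borel"
  using spectral by (simp add: spectral_measure_def)

lemma moment_integrable:
  assumes "integrable \<nu> (\<lambda>y. exp (\<epsilon> * y\<^sup>2))" "x > - \<epsilon>"
  shows "integrable \<nu> (\<lambda>y. (y\<^sup>2) ^ k * exp (- y\<^sup>2 * x))"
proof (rule Bochner_Integration.integrable_bound)
  define \<eta> where "\<eta> = x + \<epsilon>"
  have \<eta>: "\<eta> > 0" using assms by (simp add: \<eta>_def)
  show "integrable \<nu> (\<lambda>y. fact k / \<eta> ^ k * exp (\<epsilon> * y\<^sup>2))"
    using assms(1) by simp
  show "(\<lambda>y. (y\<^sup>2) ^ k * exp (- y\<^sup>2 * x)) \<in> borel_measurable \<nu>" by measurable
  show "AE y in \<nu>. norm ((y\<^sup>2) ^ k * exp (- y\<^sup>2 * x)) \<le> norm (fact k / \<eta> ^ k * exp (\<epsilon> * y\<^sup>2))"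
  proof (intro always_eventually allI)
    fix y :: real
    have "(\<eta> * y\<^sup>2) ^ k \<le> fact k * exp (\<eta> * y\<^sup>2)"
      using \<eta> by (intro power_le_fact_exp) auto
    then have "(y\<^sup>2) ^ k \<le> fact k / \<eta> ^ k * exp (\<eta> * y\<^sup>2)"
      using \<eta> by (simp add: power_mult_distrib field_simps)
    then have "(y\<^sup>2) ^ k * exp (- y\<^sup>2 * x) \<le> fact k / \<eta> ^ k * exp (\<eta> * y\<^sup>2) * exp (- y\<^sup>2 * x)"
      by (intro mult_right_mono) auto
    also have "\<dots> = fact k / \<eta> ^ k * exp (\<epsilon> * y\<^sup>2)"
      by (simp add: \<eta>_def algebra_simps flip: exp_add)
    finally show "norm ((y\<^sup>2) ^ k * exp (- y\<^sup>2 * x)) \<le> norm (fact k / \<eta> ^ k * exp (\<epsilon> * y\<^sup>2))"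
      using \<eta> by simp
  qed
qed

lemma moment_has_derivative:
  assumes int: "integrable \<nu> (\<lambda>y. exp (\<epsilon> * y\<^sup>2))" and x: "x > - \<epsilon>"
  shows "(moment k has_real_derivative - moment (Suc k) x) (at x)"
proof (rule DERIV_quadratic_remainder)
  \<comment> \<open>Half the distance from x to -eps: for |h| below it the remainder is dominated by
    the integrand at x - delta, which is still integrable.\<close>
  define \<delta> where "\<delta> = (x + \<epsilon>) / 2"
  show \<delta>: "\<delta> > 0" using x by (simp add: \<delta>_def)
  fix h :: real assume h: "\<bar>h\<bar> < \<delta>"
  have xh: "x + h > - \<epsilon>" "x - \<delta> > - \<epsilon>" using h x by (auto simp: \<delta>_def field_simps abs_less_iff)
  define e where "e j z y = (y\<^sup>2) ^ j * exp (- y\<^sup>2 * z)" for j z and y :: real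
  have I: "integrable \<nu> (e j z)" if "z > - \<epsilon>" for j z
    using moment_integrable[OF int that] by (simp add: e_def[abs_def])
  have m: "moment j z = (\<integral>y. e j z y \<partial>\<nu>)" for j z
    by (simp add: moment_def e_def)
  note i1 = Bochner_Integration.integrable_diff[OF I[OF xh(1), of k] I[OF x, of k]]
  note i2 = Bochner_Integration.integrable_mult_right[OF I[OF x, of "Suc k"], of h]
  note int3 = Bochner_Integration.integrable_add[OF i1 i2]
  have "moment k (x + h) - moment k x - h * - moment (Suc k) x
      = (\<integral>y. e k (x + h) y - e k x y + h * e (Suc k) x y \<partial>\<nu>)"
    unfolding m Bochner_Integration.integral_add[OF i1 i2]
      Bochner_Integration.integral_diff[OF I[OF xh(1), of k] I[OF x, of k]] by simp
  also have "\<bar>\<dots>\<bar> \<le> (\<integral>y. h\<^sup>2 * e (k + 2) (x - \<delta>) y \<partial>\<nu>)"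
  proof (rule integral_abs_bound_integral[OF int3])
    show "integrable \<nu> (\<lambda>y. h\<^sup>2 * e (k + 2) (x - \<delta>) y)"
      using I[OF xh(2)] by (intro Bochner_Integration.integrable_mult_right)
    fix y :: real
    define c where "c = y\<^sup>2"
    have c: "c \<ge> 0" by (simp add: c_def)
    have split: "exp (- c * (x + h)) = exp (- c * x) * exp (- (c * h))"
      by (simp add: algebra_simps flip: exp_add)
    have "c ^ k * exp (- c * (x + h)) - c ^ k * exp (- c * x) + h * (c ^ Suc k * exp (- c * x))
        = c ^ k * exp (- c * x) * (exp (- (c * h)) - 1 - (- (c * h)))"
      unfolding split by (simp add: algebra_simps)
    then have "\<bar>c ^ k * exp (- c * (x + h)) - c ^ k * exp (- c * x) + h * (c ^ Suc k * exp (- c * x))\<bar>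
        = c ^ k * exp (- c * x) * \<bar>exp (- (c * h)) - 1 - (- (c * h))\<bar>"
      using c by (simp add: abs_mult)
    also have "\<dots> \<le> c ^ k * exp (- c * x) * ((c * h)\<^sup>2 * exp \<bar>c * h\<bar>)"
      using abs_exp_minus_one_minus_le[of "- (c * h)"] c by (intro mult_left_mono) auto
    also have "exp \<bar>c * h\<bar> \<le> exp (c * \<delta>)"
      using c h by (simp add: abs_mult mult_left_mono)
    then have "c ^ k * exp (- c * x) * ((c * h)\<^sup>2 * exp \<bar>c * h\<bar>)
        \<le> c ^ k * exp (- c * x) * ((c * h)\<^sup>2 * exp (c * \<delta>))"
      using c by (intro mult_left_mono) auto
    also have "\<dots> = h\<^sup>2 * (c ^ (k + 2) * (exp (- c * x) * exp (c * \<delta>)))"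
      by (simp add: power_mult_distrib power_add power2_eq_square)
    also have "exp (- c * x) * exp (c * \<delta>) = exp (- c * (x - \<delta>))"
      by (simp add: algebra_simps flip: exp_add)
    finally show "\<bar>e k (x + h) y - e k x y + h * e (Suc k) x y\<bar> \<le> h\<^sup>2 * e (k + 2) (x - \<delta>) y"
      by (simp only: c_def e_def)
  qed
  also have "\<dots> = moment (k + 2) (x - \<delta>) * h\<^sup>2" by (simp add: m)
  finally show "\<bar>moment k (x + h) - moment k x - h * - moment (Suc k) x\<bar>
      \<le> moment (k + 2) (x - \<delta>) * h\<^sup>2" .
qed

lemma B_moment: "B \<nu> = moment 0"
  by (simp add: fun_eq_iff B_def moment_def)

lemma exponential_integrable:
  obtains \<epsilon> where "\<epsilon> > 0" "integrable \<nu> (\<lambda>y. exp (\<epsilon> * y\<^sup>2))"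
proof -
  obtain \<epsilon> where \<epsilon>: "\<epsilon> > 0" "(\<integral>\<^sup>+x. ennreal (exp (\<epsilon> * x\<^sup>2)) \<partial>\<nu>) < \<infinity>"
    using spectral by (auto simp: spectral_measure_def)
  have "integrable \<nu> (\<lambda>y. exp (\<epsilon> * y\<^sup>2))"
    using \<epsilon>(2) by (intro integrableI_nonneg) auto
  with \<epsilon>(1) that show thesis by blast
qed

lemma moment_integrable_nonneg:
  assumes "x \<ge> 0" shows "integrable \<nu> (\<lambda>y. (y\<^sup>2) ^ k * exp (- y\<^sup>2 * x))"
proof -
  obtain \<epsilon> where "\<epsilon> > 0" "integrable \<nu> (\<lambda>y. exp (\<epsilon> * y\<^sup>2))" by (rule exponential_integrable)
  then show ?thesis using moment_integrable assms by simp
qed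

lemma moment_nonneg: "moment k x \<ge> 0"
  unfolding moment_def by (rule integral_nonneg_AE) simp

lemma B_has_derivative_moment:
  assumes "x \<ge> 0" shows "(B \<nu> has_real_derivative - moment 1 x) (at x)"
proof -
  obtain \<epsilon> where "\<epsilon> > 0" "integrable \<nu> (\<lambda>y. exp (\<epsilon> * y\<^sup>2))" by (rule exponential_integrable)
  then show ?thesis using moment_has_derivative[of \<epsilon> x 0] assms by (simp add: B_moment)
qed

lemma deriv_B: "x \<ge> 0 \<Longrightarrow> deriv (B \<nu>) x = - moment 1 x"
  by (rule DERIV_imp_deriv[OF B_has_derivative_moment])

lemma B_has_derivative: "x \<ge> 0 \<Longrightarrow> (B \<nu> has_real_derivative deriv (B \<nu>) x) (at x)"
  using B_has_derivative_moment deriv_B by simp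

lemma deriv_B_has_derivative:
  assumes "x > 0" shows "(deriv (B \<nu>) has_real_derivative moment 2 x) (at x)"
proof -
  obtain \<epsilon> where "\<epsilon> > 0" "integrable \<nu> (\<lambda>y. exp (\<epsilon> * y\<^sup>2))" by (rule exponential_integrable)
  then have "((\<lambda>x. - moment 1 x) has_real_derivative moment 2 x) (at x)"
    using moment_has_derivative[of \<epsilon> x 1] assms
    by (auto intro!: derivative_eq_intros simp: numeral_2_eq_2)
  then show ?thesis
    by (rule has_field_derivative_transform_within_open[where S = "{0<..}"])
      (use assms deriv_B in auto)
qed

lemma deriv_B_nonpos: "x \<ge> 0 \<Longrightarrow> deriv (B \<nu>) x \<le> 0"
  using moment_nonneg[of 1 x] by (simp add: deriv_B)

lemma B_le_B_zero:
  assumes "x \<ge> 0" shows "B \<nu> x \<le> B \<nu> 0"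
  using assms
  by (intro DERIV_nonpos_imp_nonincreasing[of 0 x "B \<nu>"]) (auto intro: B_has_derivative deriv_B_nonpos)

text \<open>For each y the function exp(- y^2 x) lies above its tangent at z; weighting by y^2 and
  integrating gives the convexity of -B'.\<close>

lemma deriv_B_le_tangent:
  assumes "x \<ge> 0" "z \<ge> 0"
  shows "deriv (B \<nu>) x \<le> deriv (B \<nu>) z + moment 2 z * (x - z)"
proof -
  note I = moment_integrable_nonneg
  have "moment 1 z - (x - z) * moment 2 z
      = (\<integral>y. (y\<^sup>2) ^ 1 * exp (- y\<^sup>2 * z) - (x - z) * ((y\<^sup>2) ^ 2 * exp (- y\<^sup>2 * z)) \<partial>\<nu>)"
    using I[OF assms(2), of 1] I[OF assms(2), of 2] unfolding moment_def
    by (subst Bochner_Integration.integral_diff) auto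
  also have "\<dots> \<le> moment 1 x"
    unfolding moment_def
  proof (rule integral_mono)
    fix y :: real
    have "1 - y\<^sup>2 * (x - z) \<le> exp (- (y\<^sup>2 * (x - z)))"
      using exp_ge_add_one_self[of "- (y\<^sup>2 * (x - z))"] by simp
    then have "y\<^sup>2 * exp (- y\<^sup>2 * z) * (1 - y\<^sup>2 * (x - z))
        \<le> y\<^sup>2 * exp (- y\<^sup>2 * z) * exp (- (y\<^sup>2 * (x - z)))"
      by (intro mult_left_mono) auto
    also have "\<dots> = (y\<^sup>2) ^ 1 * exp (- y\<^sup>2 * x)"
      by (simp add: algebra_simps flip: exp_add)
    finally show "(y\<^sup>2) ^ 1 * exp (- y\<^sup>2 * z) - (x - z) * ((y\<^sup>2) ^ 2 * exp (- y\<^sup>2 * z))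
        \<le> (y\<^sup>2) ^ 1 * exp (- y\<^sup>2 * x)"
      by (simp add: algebra_simps power2_eq_square)
  qed (use I[OF assms(2), of 1] I[OF assms(2), of 2] I[OF assms(1), of 1] in auto)
  finally show ?thesis using assms by (simp add: deriv_B algebra_simps)
qed

lemma continuous_on_deriv_B: "continuous_on {0<..} (deriv (B \<nu>))"
  by (intro continuous_at_imp_continuous_on ballI DERIV_isCont[OF deriv_B_has_derivative]) simp

end

section \<open>Saddle pairs\<close>

locale saddle_point = resolvent L d t + covariance \<nu> + prob_space \<zeta>
  for L d :: nat and t :: real and \<nu> :: "real measure" and \<zeta> :: "real measure" +
  fixes \<mu> \<beta> q :: real
  assumes \<mu>: "\<mu> > 0" and \<beta>: "\<beta> > 0"
    and saddle: "saddle_pair L d \<mu> t \<nu> \<beta> q \<zeta>"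
begin

definition r :: real where "r = R L d t 1 \<mu>"
definition m :: "real \<Rightarrow> real" where "m u = measure \<zeta> {0..u}"
definition D :: "real \<Rightarrow> real" where "D = delta q \<zeta>"
definition k :: "real \<Rightarrow> real" where "k u = deriv (K L d t) (\<beta> * D u)"
definition FF :: "real \<Rightarrow> real" where "FF = F L d t \<nu> \<beta> q \<zeta>"
definition ff :: "real \<Rightarrow> real" where "ff = f_int L d t \<nu> \<beta> q \<zeta>"
text \<open>The end points are treated differently: q lies outside the support and is left out,
  while 0 may carry mass, and there the limit defining \<open>f_ext\<close> is \<open>ff 0\<close>
  by continuity (\<open>f_ext_eq\<close>).\<close>

definition maximiser :: "real \<Rightarrow> bool" where
  "maximiser a \<longleftrightarrow> 0 \<le> a \<and> a < q \<and> (\<forall>s\<in>{0<..<q}. ff s \<le> ff a)"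
definition mean :: real where "mean = q - r / \<beta>"

lemma q_pos: "q > 0" and sets_eq [measurable_cong, simp]: "sets \<zeta> = sets borel"
  and m_q: "m q = 1" and q_notin_supp: "q \<notin> supp \<zeta>"
  and integral_m: "integral {0..q} m = r / \<beta>"
  using saddle \<beta> by (auto simp: saddle_pair_def Y_def m_def[abs_def] r_def field_simps)

lemma space_eq [simp]: "space \<zeta> = UNIV"
  using sets_eq_imp_space_eq[OF sets_eq] by simp

lemma r_pos: "r > 0"
  using R_one_pos[OF \<mu>] by (simp add: r_def)

lemma K_r: "K L d t r = \<mu>"
  using K_R[OF \<mu>] by (simp add: r_def)

lemma gap:
  obtains p where "0 < p" "p < q" "measure \<zeta> {p..q} = 0"
proof -
  obtain U where U: "open U" "q \<in> U" "emeasure \<zeta> U = 0"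
    using q_notin_supp by (auto simp: supp_def)
  obtain e where e: "e > 0" "ball q e \<subseteq> U" using U by (meson openE)
  define p where "p = max (q / 2) (q - e / 2)"
  have p: "0 < p" "p < q" "q - e < p" using q_pos e by (auto simp: p_def)
  have "{p..q} \<subseteq> U" using e p by (auto simp: dist_real_def subset_iff)
  then have "emeasure \<zeta> {p..q} \<le> emeasure \<zeta> U"
    using U(1) by (intro emeasure_mono) auto
  then have "measure \<zeta> {p..q} = 0" using U(3) by (simp add: measure_def)
  with p that show thesis by blast
qed

section \<open>The distribution function \<open>m\<close> and its tail integral
  \<open>D\<close>\<close>

lemma m_mono: "u \<le> v \<Longrightarrow> m u \<le> m v"
  unfolding m_def by (intro finite_measure_mono) auto

lemma m_le_one: "m u \<le> 1" and m_nonneg: "m u \<ge> 0"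
  by (simp_all add: m_def)

lemma m_eq_one:
  assumes "measure \<zeta> {p..q} = 0" "p \<le> u" shows "m u = 1"
proof -
  have "measure \<zeta> {0..q} \<le> measure \<zeta> ({0..u} \<union> {p..q})"
    using assms by (intro finite_measure_mono) auto
  also have "\<dots> \<le> measure \<zeta> {0..u} + measure \<zeta> {p..q}"
    by (intro measure_Un_le) auto
  finally have "1 \<le> m u" using m_q assms by (simp add: m_def)
  then show ?thesis using m_le_one[of u] by simp
qed

lemma m_integrable: "m integrable_on {a..b}"
  by (intro integrable_on_mono_on mono_onI m_mono)

lemma D_eq: "D s = integral {s..q} m"
  by (simp add: D_def delta_def m_def[abs_def])

lemma D_split:
  assumes "0 \<le> s" "s \<le> q" shows "D s = r / \<beta> - integral {0..s} m"
  using Henstock_Kurzweil_Integration.integral_combine[OF assms m_integrable] integral_m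
  by (simp add: D_eq)

lemma D_continuous: "continuous_on {0..q} D"
  unfolding D_eq[abs_def] by (rule indefinite_integral_continuous_1'[OF m_integrable])

lemma integral_m_le_const:
  assumes "a \<le> b" shows "integral {a..b} m \<le> (b - a) * m b"
proof -
  have "integral {a..b} m \<le> integral {a..b} (\<lambda>_. m b)"
    by (intro Henstock_Kurzweil_Integration.integral_le m_integrable integrable_const_ivl m_mono) simp
  then show ?thesis using assms by simp
qed

lemma integral_m_le: "a \<le> b \<Longrightarrow> integral {a..b} m \<le> b - a"
  using integral_m_le_const[of a b] mult_left_mono[OF m_le_one[of b], of "b - a"] by simp

lemma integral_m_ge:
  assumes "a \<le> b" shows "(b - a) * m a \<le> integral {a..b} m"
proof -
  have "integral {a..b} (\<lambda>_. m a) \<le> integral {a..b} m"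
    by (intro Henstock_Kurzweil_Integration.integral_le m_integrable integrable_const_ivl m_mono) simp
  then show ?thesis using assms by simp
qed

lemma integral_m_nonneg: "integral {a..b} m \<ge> 0"
  by (intro Henstock_Kurzweil_Integration.integral_nonneg m_integrable m_nonneg)

text \<open>This bound and the next are attained on the right and on the left of the atom,
  respectively, when zeta is a Dirac mass (\<open>D_above\<close>, \<open>D_below\<close>). So the
  Dirac profile is the extremal one in every comparison.\<close>

lemma D_le: "s \<le> q \<Longrightarrow> D s \<le> q - s"
  by (simp add: D_eq integral_m_le)

lemma D_le_r: "0 \<le> s \<Longrightarrow> s \<le> q \<Longrightarrow> D s \<le> r / \<beta>"
  using D_split integral_m_nonneg[of 0 s] by simp

text \<open>\<open>m\<close> equals 1 near q, so the tail integral stays positive up to q and K' is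
  only evaluated inside its domain.\<close>

lemma D_pos:
  assumes "s < q" shows "D s > 0"
proof -
  obtain p where p: "0 < p" "p < q" "measure \<zeta> {p..q} = 0" by (rule gap)
  define v where "v = max s p"
  have v: "s \<le> v" "p \<le> v" "v < q" using p assms by (auto simp: v_def)
  have "(q - v) * m v \<le> integral {v..q} m" using v by (intro integral_m_ge) simp
  then have "q - v \<le> integral {v..q} m" using m_eq_one[OF p(3) v(2)] by simp
  also have "\<dots> \<le> integral {s..v} m + integral {v..q} m" using integral_m_nonneg by simp
  also have "\<dots> = D s"
    using Henstock_Kurzweil_Integration.integral_combine[of s v q m] v m_integrable by (simp add: D_eq)
  finally show ?thesis using v by simp
qed

section \<open>Continuity and derivatives of F and f\<close>

lemma k_continuous:
  assumes "x < q" shows "continuous_on {0..x} k"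
proof -
  have "continuous_on {0..x} (\<lambda>u. \<beta> * D u)"
    using assms by (intro continuous_intros continuous_on_subset[OF D_continuous]) auto
  moreover have "(\<lambda>u. \<beta> * D u) ` {0..x} \<subseteq> {0<..}"
    using assms \<beta> D_pos by auto
  ultimately show ?thesis
    unfolding k_def[abs_def] by (intro continuous_on_compose2[OF continuous_on_deriv_K]) auto
qed

lemma k_le:
  assumes "s < q" "D s \<le> b"
  shows "k s \<le> deriv (K L d t) (\<beta> * b)"
  unfolding k_def using assms D_pos \<beta> by (intro deriv_K_mono) auto

lemma k_less:
  assumes "s < q" "D s < b"
  shows "k s < deriv (K L d t) (\<beta> * b)"
  unfolding k_def using assms D_pos \<beta> by (intro deriv_K_strict_mono) auto

lemma FF_eq: "FF s = - 2 * deriv (B \<nu>) (2 * (q - s)) + integral {0..s} k"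
  by (simp add: FF_def F_def k_def[abs_def] D_def)

lemma FF_continuous:
  assumes "x < q" shows "continuous_on {0..x} FF"
proof -
  have "continuous_on {0..x} (\<lambda>s. deriv (B \<nu>) (2 * (q - s)))"
    by (rule continuous_on_compose2[OF continuous_on_deriv_B])
      (use assms in \<open>auto intro!: continuous_intros\<close>)
  then show ?thesis
    unfolding FF_eq[abs_def]
    by (intro continuous_on_add continuous_on_mult_left indefinite_integral_continuous_1
        integrable_continuous_real k_continuous[OF assms])
qed

lemma FF_diff:
  assumes "0 \<le> a" "a \<le> b" "b < q"
  shows "FF b - FF a = - 2 * deriv (B \<nu>) (2 * (q - b)) + 2 * deriv (B \<nu>) (2 * (q - a)) + integral {a..b} k"
  using Henstock_Kurzweil_Integration.integral_combine[OF assms(1,2) integrable_continuous_real[OF k_continuous[OF assms(3)]]]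
  by (simp add: FF_eq)

lemma ff_eq: "ff s = integral {0..s} FF"
  by (simp add: ff_def f_int_def FF_def)

lemma ff_continuous: "x < q \<Longrightarrow> continuous_on {0..x} ff"
  unfolding ff_eq[abs_def]
  by (intro indefinite_integral_continuous_1 integrable_continuous_real FF_continuous)

text \<open>Includes the one-sided derivative at 0, needed in \<open>FF_dirac_zero\<close> when the
  atom sits at 0.\<close>

lemma ff_derivative_within:
  assumes "x < q" "s \<in> {0..x}"
  shows "(ff has_real_derivative FF s) (at s within {0..x})"
  unfolding ff_eq[abs_def]
  using integral_has_real_derivative[OF FF_continuous[OF assms(1)] assms(2)] .

lemma ff_derivative:
  assumes "0 < s" "s < q" shows "(ff has_real_derivative FF s) (at s)"
proof -
  define x where "x = (s + q) / 2"
  have x: "s < x" "x < q" using assms by (auto simp: x_def)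
  have "at s within {0..x} = at s"
    using assms x by (intro at_within_interior) auto
  then show ?thesis using ff_derivative_within[OF x(2), of s] assms x by simp
qed

lemma f_ext_eq:
  assumes "0 \<le> s" "s < q"
  shows "f_ext L d t \<nu> \<beta> q \<zeta> s = ereal (ff s)"
proof (cases "s = 0")
  case False
  then show ?thesis using assms by (simp add: f_ext_def ff_def)
next
  case True
  have "continuous_on {0..q/2} ff" using q_pos by (intro ff_continuous) simp
  then have "(ff \<longlongrightarrow> ff 0) (at 0 within {0..q/2})"
    using q_pos by (auto simp: continuous_on_def)
  moreover have "at 0 within {0..q/2} = at_right 0"
    using q_pos by (simp add: at_within_Icc_at_right)
  moreover have "at 0 within {0<..<q} = at_right 0"
  proof (rule at_within_nhd)
    show "0 \<in> {..<q}" using q_pos by simp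
    show "{0<..<q} \<inter> {..<q} - {0} = {0<..} \<inter> {..<q} - {0}" by auto
  qed simp
  ultimately have "((\<lambda>s. ereal (ff s)) \<longlongrightarrow> ereal (ff 0)) (at 0 within {0<..<q})"
    by simp
  moreover have "at 0 within {0<..<q} \<noteq> bot"
    using \<open>at 0 within {0<..<q} = at_right 0\<close> by simp
  ultimately have "Lim (at 0 within {0<..<q}) (\<lambda>s. ereal (ff s)) = ereal (ff 0)"
    by (intro tendsto_Lim)
  then show ?thesis using True by (simp add: f_ext_def ff_def)
qed

text \<open>Almost every point is a maximiser of f, so a set of positive mass must contain one. The
  point q is harmless because it lies in the null interval of \<open>gap\<close>.\<close>

lemma maximiser_exists:
  assumes E: "E \<in> sets borel" and pos: "measure \<zeta> E > 0"
  shows "\<exists>a\<in>E. maximiser a"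
proof (rule ccontr)
  assume none: "\<not> ?thesis"
  define A where "A = {s \<in> {0..q}. f_ext L d t \<nu> \<beta> q \<zeta> s =
       (SUP s'\<in>{0<..<q}. ereal (f_int L d t \<nu> \<beta> q \<zeta> s'))}"
  have A: "measure \<zeta> A = 1"
    using saddle by (simp add: saddle_pair_def A_def)
  \<comment> \<open>Non-measurable sets have \<open>measure\<close> 0 by convention, so measure 1
    already forces measurability.\<close>
  then have As: "A \<in> sets \<zeta>" by (metis measure_notin_sets zero_neq_one)
  have "maximiser a" if "a \<in> A" "a \<noteq> q" for a
  proof -
    have a: "0 \<le> a" "a < q" using that by (auto simp: A_def)
    then have max: "ereal (ff a) = (SUP s'\<in>{0<..<q}. ereal (ff s'))"
      using that f_ext_eq by (simp add: A_def ff_def)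
    have "ereal (ff s) \<le> ereal (ff a)" if "s \<in> {0<..<q}" for s
      unfolding max by (rule SUP_upper[OF that])
    with a show ?thesis by (auto simp: maximiser_def)
  qed
  then have "A \<inter> E \<subseteq> {q}" using none by blast
  obtain p where p: "p < q" "measure \<zeta> {p..q} = 0" using gap by metis
  have "measure \<zeta> E \<le> measure \<zeta> (A \<inter> E) + measure \<zeta> (UNIV - A)"
  proof -
    have "measure \<zeta> E \<le> measure \<zeta> ((A \<inter> E) \<union> (UNIV - A))"
      using As E by (intro finite_measure_mono) auto
    also have "\<dots> \<le> measure \<zeta> (A \<inter> E) + measure \<zeta> (UNIV - A)"
      using As E by (intro measure_Un_le) auto
    finally show ?thesis .
  qed
  also have "measure \<zeta> (UNIV - A) = 0"
    using prob_compl[OF As] A by simp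
  also have "measure \<zeta> (A \<inter> E) \<le> measure \<zeta> {p..q}"
    using \<open>A \<inter> E \<subseteq> {q}\<close> p(1) by (intro finite_measure_mono) auto
  finally show False using pos p by simp
qed

section \<open>The mean of zeta, and when zeta is a Dirac mass\<close>

lemma mean_bounds: "0 \<le> mean" "mean < q"
  using integral_m_le[of 0 q] q_pos integral_m r_pos \<beta> by (auto simp: mean_def)

lemma beta_q_mean: "\<beta> * (q - mean) = r" "2 * (q - mean) = 2 / \<beta> * r"
  using \<beta> by (auto simp: mean_def)

text \<open>\<open>m\<close> sees only [0, u]; the negative half line adds nothing since [0, q]
  already has full mass.\<close>

lemma null_below:
  assumes "u \<le> q" "m u = 0" shows "measure \<zeta> {..u} = 0"
proof -
  have "measure \<zeta> ({..u} \<union> {0..q}) = measure \<zeta> ({..u} - {0..u}) + measure \<zeta> {0..q}"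
  proof -
    have "{..u} \<union> {0..q} = ({..u} - {0..u}) \<union> {0..q}" using assms by auto
    moreover have "({..u} - {0..u}) \<inter> {0..q} = {}" by auto
    ultimately show ?thesis by (simp add: finite_measure_Union)
  qed
  then have z: "measure \<zeta> ({..u} - {0..u}) = 0"
    using m_q prob_le_1[of "{..u} \<union> {0..q}"] measure_nonneg[of \<zeta> "{..u} - {0..u}"]
    unfolding m_def by linarith
  have "measure \<zeta> {..u} \<le> measure \<zeta> (({..u} - {0..u}) \<union> {0..u})"
    by (intro finite_measure_mono) auto
  also have "\<dots> \<le> measure \<zeta> ({..u} - {0..u}) + measure \<zeta> {0..u}"
    by (intro measure_Un_le) auto
  finally show ?thesis using z assms(2) by (simp add: m_def measure_le_0_iff)
qed

lemma null_above:
  assumes "m u = 1" shows "measure \<zeta> {u<..} = 0"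
proof -
  have "measure \<zeta> ({u<..} \<union> {0..u}) = measure \<zeta> {u<..} + measure \<zeta> {0..u}"
    by (intro finite_measure_Union) auto
  then show ?thesis
    using assms prob_le_1[of "{u<..} \<union> {0..u}"] measure_nonneg[of \<zeta> "{u<..}"]
    unfolding m_def by linarith
qed

lemma null_below_open:
  assumes "x \<le> q" "\<And>u. u < x \<Longrightarrow> m u = 0" shows "{..<x} \<in> null_sets \<zeta>"
proof -
  have null: "(\<Union>n. {..x - 1 / real (Suc n)}) \<in> null_sets \<zeta>"
  proof (rule null_sets_UN)
    fix n
    have "measure \<zeta> {..x - 1 / real (Suc n)} = 0"
      using assms by (intro null_below order_trans[OF _ assms(1)]) auto
    then show "{..x - 1 / real (Suc n)} \<in> null_sets \<zeta>"
      by (auto simp: null_sets_def emeasure_eq_measure)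
  qed
  have sub: "{..<x} \<subseteq> (\<Union>n. {..x - 1 / real (Suc n)})"
  proof
    fix y assume "y \<in> {..<x}"
    then obtain n where "inverse (real (Suc n)) < x - y"
      using reals_Archimedean[of "x - y"] by auto
    then show "y \<in> (\<Union>n. {..x - 1 / real (Suc n)})" by (auto simp: field_simps intro!: exI[of _ n])
  qed
  show ?thesis by (rule null_sets_subset[OF null _ sub]) simp
qed

lemma null_above_open:
  assumes "\<And>u. u > x \<Longrightarrow> m u = 1" shows "{x<..} \<in> null_sets \<zeta>"
proof -
  have null: "(\<Union>n. {x + 1 / real (Suc n)<..}) \<in> null_sets \<zeta>"
  proof (rule null_sets_UN)
    fix n
    have "measure \<zeta> {x + 1 / real (Suc n)<..} = 0"
      using assms by (intro null_above) auto
    then show "{x + 1 / real (Suc n)<..} \<in> null_sets \<zeta>"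
      by (auto simp: null_sets_def emeasure_eq_measure)
  qed
  have sub: "{x<..} \<subseteq> (\<Union>n. {x + 1 / real (Suc n)<..})"
  proof
    fix y assume "y \<in> {x<..}"
    then obtain n where "inverse (real (Suc n)) < y - x"
      using reals_Archimedean[of "y - x"] by auto
    then show "y \<in> (\<Union>n. {x + 1 / real (Suc n)<..})" by (auto simp: field_simps intro!: exI[of _ n])
  qed
  show ?thesis by (rule null_sets_subset[OF null _ sub]) simp
qed

text \<open>Mass on one side of the mean forces mass on the other, by the balance \<open>\<integral>\<^bsub>[0,mean]\<^esub> m = \<integral>\<^bsub>[mean,q]\<^esub> (1 - m)\<close>.\<close>

lemma dirac_or_spread:
  assumes "\<zeta> \<noteq> return borel mean"
  obtains u where "0 \<le> u" "u < mean" "m u > 0"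
    and "measure \<zeta> {..<mean} > 0" "measure \<zeta> {mean<..} > 0"
proof -
  have split: "integral {0..mean} m + integral {mean..q} m = q - mean"
    using Henstock_Kurzweil_Integration.integral_combine[of 0 mean q m] mean_bounds m_integrable
      integral_m by (simp add: mean_def)
  have m_neg: "m u = 0" if "u < 0" for u using that by (simp add: m_def)
  have below_iff: "(\<forall>u<mean. m u = 0) \<longleftrightarrow> integral {0..mean} m = 0"
  proof
    assume z: "\<forall>u<mean. m u = 0"
    have "integral {0..mean} m = integral {0..mean} (\<lambda>_. 0)"
      by (rule integral_spike[of "{mean}"]) (use z in auto)
    then show "integral {0..mean} m = 0" by simp
  next
    assume z: "integral {0..mean} m = 0"
    show "\<forall>u<mean. m u = 0"
    proof (intro allI impI)
      fix u assume u: "u < mean"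
      show "m u = 0"
      proof (cases "u < 0")
        case False
        have "(mean - u) * m u \<le> integral {u..mean} m" using u by (intro integral_m_ge) simp
        also have "\<dots> \<le> integral {0..mean} m"
          using Henstock_Kurzweil_Integration.integral_combine[of 0 u mean m] False u m_integrable
            integral_m_nonneg[of 0 u] by simp
        finally have "(mean - u) * m u \<le> 0" using z by simp
        then show ?thesis using u m_nonneg[of u] by (simp add: mult_le_0_iff)
      qed (simp add: m_neg)
    qed
  qed
  have above_iff: "(\<forall>u>mean. m u = 1) \<longleftrightarrow> integral {mean..q} m = q - mean"
  proof
    assume z: "\<forall>u>mean. m u = 1"
    have "integral {mean..q} m = integral {mean..q} (\<lambda>_. 1)"
      by (rule integral_spike[of "{mean}"]) (use z in auto)
    then show "integral {mean..q} m = q - mean" using mean_bounds by simp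
  next
    assume z: "integral {mean..q} m = q - mean"
    show "\<forall>u>mean. m u = 1"
    proof (intro allI impI)
      fix u assume u: "u > mean"
      show "m u = 1"
      proof (cases "u \<le> q")
        case True
        have "q - mean = integral {mean..u} m + integral {u..q} m"
          using Henstock_Kurzweil_Integration.integral_combine[of mean u q m] True u m_integrable z by simp
        also have "integral {mean..u} m \<le> (u - mean) * m u"
          using u by (intro integral_m_le_const) simp
        also have "integral {u..q} m \<le> q - u" using True by (intro integral_m_le)
        finally have "(u - mean) * 1 \<le> (u - mean) * m u" by simp
        then have "1 \<le> m u" using u by (subst (asm) mult_le_cancel_left_pos) auto
        then show ?thesis using m_le_one[of u] by simp
      next
        case False
        then show ?thesis using m_mono[of q u] m_q m_le_one[of u] by simp
      qed
    qed
  qed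
  have dirac: "\<zeta> = return borel mean" if "{..<mean} \<in> null_sets \<zeta>" "{mean<..} \<in> null_sets \<zeta>"
  proof (rule measure_eqI)
    fix A assume "A \<in> sets \<zeta>"
    have "{..<mean} \<union> {mean<..} \<in> null_sets \<zeta>" using that by auto
    then have ae: "AE x in \<zeta>. x = mean" by (rule AE_I') auto
    show "emeasure \<zeta> A = emeasure (return borel mean) A"
    proof (cases "mean \<in> A")
      case True
      have "emeasure \<zeta> A = emeasure \<zeta> UNIV"
        by (rule emeasure_eq_AE) (use ae True \<open>A \<in> sets \<zeta>\<close> in auto)
      then show ?thesis using True \<open>A \<in> sets \<zeta>\<close> emeasure_space_1 by simp
    next
      case False
      have "emeasure \<zeta> A = emeasure \<zeta> {}"
        by (rule emeasure_eq_AE) (use ae False \<open>A \<in> sets \<zeta>\<close> in auto)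
      then show ?thesis using False \<open>A \<in> sets \<zeta>\<close> by simp
    qed
  qed simp
  have "\<not> (\<forall>u<mean. m u = 0)"
  proof
    assume b: "\<forall>u<mean. m u = 0"
    then have "\<forall>u>mean. m u = 1" using below_iff above_iff split by simp
    then show False using b dirac null_below_open null_above_open mean_bounds assms by auto
  qed
  then obtain u where u: "u < mean" "m u > 0" using m_nonneg by (metis less_le)
  have "\<not> (\<forall>u>mean. m u = 1)"
    using \<open>\<not> (\<forall>u<mean. m u = 0)\<close> below_iff above_iff split by simp
  then obtain v where v: "v > mean" "m v \<noteq> 1" by blast
  have "measure \<zeta> {..<mean} \<ge> m u"
    unfolding m_def using u by (intro finite_measure_mono) auto
  then have 1: "measure \<zeta> {..<mean} > 0" using u by simp
  have 2: "measure \<zeta> {mean<..} > 0"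
  proof (rule ccontr)
    assume "\<not> ?thesis"
    then have z: "measure \<zeta> {mean<..} = 0" by (simp add: measure_le_0_iff not_less)
    have "m q \<le> measure \<zeta> ({0..v} \<union> {mean<..})"
      unfolding m_def using v by (intro finite_measure_mono) auto
    also have "\<dots> \<le> m v + measure \<zeta> {mean<..}"
      unfolding m_def by (intro measure_Un_le) auto
    finally show False using z m_q v m_le_one[of v] by simp
  qed
  have "0 \<le> u" using m_neg[of u] u by (cases "u < 0") auto
  then show thesis using that u 1 2 by blast
qed

end

section \<open>Replica symmetry\<close>

context saddle_point
begin

section \<open>The function g, its derivatives and its supremum\<close>

definition gg :: "real \<Rightarrow> real" where "gg = g L d \<mu> t \<nu> \<beta>"
text \<open>The determinant part of g contributes just K, by \<open>K_primitive\<close>. The two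
  constants come from the linear term of g; they are the values of the other two terms at r, since
  K(r) = mu.\<close>

definition g' :: "real \<Rightarrow> real" where
  "g' x = 2 * \<beta> * deriv (B \<nu>) (2 / \<beta> * x) + K L d t x - 2 * \<beta> * deriv (B \<nu>) (2 / \<beta> * r) - \<mu>"

lemma gg_eq: "gg x = \<beta>\<^sup>2 * B \<nu> (2 / \<beta> * x)
    + (x * K L d t x - 1 / real (L ^ d) * logdet L d t (K L d t x))
    - x * (2 * \<beta> * deriv (B \<nu>) (2 / \<beta> * r) + \<mu>)"
  by (simp add: gg_def g_def r_def)

lemma gg_derivative:
  assumes "x > 0" shows "(gg has_real_derivative g' x) (at x)"
proof -
  have "((\<lambda>x. B \<nu> (2 / \<beta> * x)) has_real_derivative deriv (B \<nu>) (2 / \<beta> * x) * (2 / \<beta>)) (at x)"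
    by (rule DERIV_chain2[OF B_has_derivative]) (use assms \<beta> in \<open>auto intro!: derivative_eq_intros\<close>)
  then have "(gg has_real_derivative \<beta>\<^sup>2 * (deriv (B \<nu>) (2 / \<beta> * x) * (2 / \<beta>)) + K L d t x
      - 1 * (2 * \<beta> * deriv (B \<nu>) (2 / \<beta> * r) + \<mu>)) (at x)"
    unfolding gg_eq[abs_def]
    by (intro DERIV_diff DERIV_add DERIV_cmult DERIV_cmult_right DERIV_ident K_primitive assms)
  then show ?thesis
    by (rule DERIV_cong) (use \<beta> in \<open>simp add: g'_def power2_eq_square\<close>)
qed

lemma g'_r: "g' r = 0"
  by (simp add: g'_def K_r)

lemma g'_derivative:
  assumes "x > 0"
  shows "(g' has_real_derivative 4 * moment 2 (2 / \<beta> * x) + deriv (K L d t) x) (at x)"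
proof -
  have "((\<lambda>x. deriv (B \<nu>) (2 / \<beta> * x)) has_real_derivative moment 2 (2 / \<beta> * x) * (2 / \<beta>)) (at x)"
    by (rule DERIV_chain2[OF deriv_B_has_derivative]) (use assms \<beta> in \<open>auto intro!: derivative_eq_intros\<close>)
  then show ?thesis
    unfolding g'_def[abs_def] using \<beta>
    by (auto intro!: derivative_eq_intros K_has_deriv[OF assms] simp: field_simps)
qed

text \<open>As g'(r) = 0, a positive g''(r) would make g' negative just left of r, and g would
  exceed g(r) there.\<close>

lemma second_derivative_nonpos:
  assumes "\<And>x. 0 < x \<Longrightarrow> x < r \<Longrightarrow> gg x \<le> gg r"
  shows "4 * moment 2 (2 / \<beta> * r) + deriv (K L d t) r \<le> 0"
proof (rule ccontr)
  assume "\<not> ?thesis"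
  then obtain e where e: "e > 0" "\<And>h. h > 0 \<Longrightarrow> h < e \<Longrightarrow> g' (r - h) < g' r"
    using DERIV_pos_inc_left[OF g'_derivative[OF r_pos]] by auto
  define y where "y = max (r / 2) (r - e / 2)"
  have y: "0 < y" "y < r" "r - e < y" using r_pos e(1) by (auto simp: y_def)
  have "gg r < gg y"
  proof (rule DERIV_neg_imp_decreasing_open[OF y(2)])
    show "continuous_on {y..r} gg"
      using y by (intro continuous_at_imp_continuous_on ballI DERIV_isCont[OF gg_derivative]) auto
    fix x assume x: "y < x" "x < r"
    then have "g' x < 0" using e(2)[of "r - x"] y g'_r by simp
    then show "\<exists>z. (gg has_real_derivative z) (at x) \<and> z < 0"
      using gg_derivative[of x] x y by auto
  qed
  then show False using assms[OF y(1,2)] by simp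
qed

text \<open>A real \<open>SUP\<close> carries information only for sets bounded above. The bound
  holds up to x = 0 because the primitive of K is increasing and \<open>B\<close> is largest at
  0.\<close>

lemma gg_bdd_above: "bdd_above (gg ` {0<..<r})"
proof -
  define G where "G x = x * K L d t x - 1 / real (L ^ d) * logdet L d t (K L d t x)" for x
  define C where "C = 2 * \<beta> * deriv (B \<nu>) (2 / \<beta> * r) + \<mu>"
  have "gg x \<le> \<beta>\<^sup>2 * B \<nu> 0 + G r + r * \<bar>C\<bar>" if x: "0 < x" "x < r" for x
  proof -
    have "G x \<le> G r"
    proof (rule DERIV_nonneg_imp_nondecreasing[where f = G])
      show "x \<le> r" using x by simp
      fix y assume "x \<le> y" "y \<le> r"
      then have "y > 0" using x by simp
      then show "\<exists>z. (G has_real_derivative z) (at y) \<and> 0 \<le> z"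
        using K_primitive[of y] K_pos[of y] by (auto simp: G_def[abs_def] intro: less_imp_le)
    qed
    moreover have "\<beta>\<^sup>2 * B \<nu> (2 / \<beta> * x) \<le> \<beta>\<^sup>2 * B \<nu> 0"
      using x \<beta> by (intro mult_left_mono B_le_B_zero) auto
    moreover have "- (x * C) \<le> r * \<bar>C\<bar>"
    proof -
      have "- (x * C) \<le> \<bar>x * C\<bar>" by simp
      also have "\<dots> = x * \<bar>C\<bar>" using x by (simp add: abs_mult)
      also have "\<dots> \<le> r * \<bar>C\<bar>" using x by (intro mult_right_mono) auto
      finally show ?thesis .
    qed
    ultimately show ?thesis by (simp add: gg_eq G_def C_def)
  qed
  then show ?thesis by (intro bdd_aboveI2) auto
qed

text \<open>The interval is open at r, so the supremum reaches g(r) only through left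
  continuity.\<close>

lemma sup_gg_iff:
  "(SUP s\<in>{0<..<r}. gg s) = gg r \<longleftrightarrow> (\<forall>x. 0 < x \<and> x < r \<longrightarrow> gg x \<le> gg r)"
proof
  assume sup: "(SUP s\<in>{0<..<r}. gg s) = gg r"
  show "\<forall>x. 0 < x \<and> x < r \<longrightarrow> gg x \<le> gg r"
    using cSUP_upper[OF _ gg_bdd_above] unfolding sup by auto
next
  assume le: "\<forall>x. 0 < x \<and> x < r \<longrightarrow> gg x \<le> gg r"
  have "(SUP s\<in>{0<..<r}. gg s) \<le> gg r"
    using le r_pos by (intro cSUP_least) auto
  moreover have "gg r \<le> (SUP s\<in>{0<..<r}. gg s)"
  proof (rule tendsto_upperbound)
    show "(gg \<longlongrightarrow> gg r) (at_left r)"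
      using DERIV_isCont[OF gg_derivative[OF r_pos]] by (simp add: isCont_def filterlim_at_split)
    have "\<forall>\<^sub>F x in at_left r. x \<in> {0<..<r}"
      using r_pos by (rule eventually_at_left_real)
    then show "\<forall>\<^sub>F x in at_left r. gg x \<le> (SUP s\<in>{0<..<r}. gg s)"
      by eventually_elim (rule cSUP_upper[OF _ gg_bdd_above])
  qed simp
  ultimately show "(SUP s\<in>{0<..<r}. gg s) = gg r" by simp
qed

section \<open>Comparison of f with g in the reflected variable beta (q - s)\<close>

lemma gg_reflected_derivative:
  assumes "s < q"
  shows "((\<lambda>s. gg (\<beta> * (q - s)) / \<beta>\<^sup>2) has_real_derivative - g' (\<beta> * (q - s)) / \<beta>) (at s)"
proof -
  have "((\<lambda>s. gg (\<beta> * (q - s))) has_real_derivative g' (\<beta> * (q - s)) * (- \<beta>)) (at s)"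
    by (rule DERIV_chain2[OF gg_derivative])
      (use assms \<beta> in \<open>auto intro!: derivative_eq_intros\<close>)
  then show ?thesis using \<beta>
    by (auto intro!: derivative_eq_intros simp: field_simps power2_eq_square)
qed

lemma integral_deriv_K:
  assumes "a \<le> b" "b < q"
  shows "((\<lambda>u. deriv (K L d t) (\<beta> * (q - u))) has_integral
    (K L d t (\<beta> * (q - a)) - K L d t (\<beta> * (q - b))) / \<beta>) {a..b}"
proof -
  have "((\<lambda>u. - K L d t (\<beta> * (q - u)) / \<beta>) has_real_derivative deriv (K L d t) (\<beta> * (q - u))) (at u within {a..b})"
    if "u \<in> {a..b}" for u
  proof -
    have "((\<lambda>u. K L d t (\<beta> * (q - u))) has_real_derivative deriv (K L d t) (\<beta> * (q - u)) * (- \<beta>)) (at u within {a..b})"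
      by (rule DERIV_chain2[OF K_has_deriv])
        (use assms \<beta> that in \<open>auto intro!: derivative_eq_intros\<close>)
    then show ?thesis using \<beta> by (auto intro!: derivative_eq_intros)
  qed
  then have "((\<lambda>u. deriv (K L d t) (\<beta> * (q - u))) has_integral
      (- K L d t (\<beta> * (q - b)) / \<beta> - (- K L d t (\<beta> * (q - a)) / \<beta>))) {a..b}"
    using assms by (intro fundamental_theorem_of_calculus)
      (auto simp: has_real_derivative_iff_has_vector_derivative)
  then show ?thesis by (simp add: diff_divide_distrib)
qed

text \<open>The right-hand side is the growth that F would have if \<open>D u\<close> were q - u, as
  it is for a Dirac mass. In general \<open>D u\<close> <= q - u, and since K' increases this can
  only lower the growth.\<close>

lemma FF_above_mean:
  assumes "mean \<le> s" "s < q"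
  shows "FF s - FF mean \<le> - g' (\<beta> * (q - s)) / \<beta>"
    and "(\<And>u. mean \<le> u \<Longrightarrow> u < q \<Longrightarrow> D u = q - u) \<Longrightarrow> FF s - FF mean = - g' (\<beta> * (q - s)) / \<beta>"
proof -
  define I where "I = (\<mu> - K L d t (\<beta> * (q - s))) / \<beta>"
  have int: "((\<lambda>u. deriv (K L d t) (\<beta> * (q - u))) has_integral I) {mean..s}"
    using integral_deriv_K[OF assms] by (simp add: I_def beta_q_mean K_r)
  have kint: "k integrable_on {mean..s}"
    using mean_bounds assms
    by (intro integrable_continuous_real continuous_on_subset[OF k_continuous[OF assms(2)]]) auto
  have rhs: "- g' (\<beta> * (q - s)) / \<beta>
      = - 2 * deriv (B \<nu>) (2 * (q - s)) + 2 * deriv (B \<nu>) (2 * (q - mean)) + I"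
  proof -
    have "2 / \<beta> * (\<beta> * (q - s)) = 2 * (q - s)" using \<beta> by simp
    then show ?thesis
      unfolding g'_def I_def beta_q_mean(2) using \<beta> by (simp add: diff_divide_distrib add_divide_distrib)
  qed
  have diff: "FF s - FF mean = - 2 * deriv (B \<nu>) (2 * (q - s)) + 2 * deriv (B \<nu>) (2 * (q - mean)) + integral {mean..s} k"
    using FF_diff mean_bounds assms by simp
  have "integral {mean..s} k \<le> I"
    unfolding integral_unique[OF int, symmetric]
    using int assms D_le kint
    by (intro Henstock_Kurzweil_Integration.integral_le k_le) (auto simp: has_integral_integrable)
  then show "FF s - FF mean \<le> - g' (\<beta> * (q - s)) / \<beta>" unfolding rhs diff by simp
  assume eq: "\<And>u. mean \<le> u \<Longrightarrow> u < q \<Longrightarrow> D u = q - u"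
  have "integral {mean..s} k = integral {mean..s} (\<lambda>u. deriv (K L d t) (\<beta> * (q - u)))"
    using assms eq by (intro Henstock_Kurzweil_Integration.integral_cong) (auto simp: k_def)
  then show "FF s - FF mean = - g' (\<beta> * (q - s)) / \<beta>"
    unfolding rhs diff using integral_unique[OF int] by simp
qed

text \<open>The concavity of \<open>B'\<close> and \<open>g'' \<le> 0\<close> give \<open>F > F mean\<close> on the left of \<open>mean\<close>.\<close>

lemma dirac_if_gg_max:
  assumes max: "\<And>x. 0 < x \<Longrightarrow> x < r \<Longrightarrow> gg x \<le> gg r"
  shows "\<zeta> = return borel mean"
proof (rule ccontr)
  assume "\<zeta> \<noteq> return borel mean"
  then obtain u where u: "0 \<le> u" "u < mean" "m u > 0"
    and pos: "measure \<zeta> {..<mean} > 0" "measure \<zeta> {mean<..} > 0"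
    by (rule dirac_or_spread)
  obtain a where a: "a < mean" "maximiser a" using maximiser_exists[OF _ pos(1)] by auto
  obtain b where b: "mean < b" "maximiser b" using maximiser_exists[OF _ pos(2)] by auto
  have a0: "0 \<le> a" and bq: "b < q" using a b by (auto simp: maximiser_def)
  have mean0: "0 < mean" using a0 a by simp
  define k0 where "k0 = deriv (K L d t) r"
  have k_le0: "k s \<le> k0" if "0 \<le> s" "s \<le> mean" for s
    using k_le[of s "r / \<beta>"] D_le_r[of s] that mean_bounds \<beta> by (simp add: k0_def)
  \<comment> \<open>Mass strictly below the mean makes this strict, hence K'(beta D(mean)) < K'(r);
    the contradiction at the end of the proof depends on that strictness.\<close>
  have "D mean < r / \<beta>"
  proof -
    have "0 < (mean - u) * m u" using u by simp
    also have "\<dots> \<le> integral {u..mean} m" using u by (intro integral_m_ge) simp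
    also have "\<dots> \<le> integral {0..mean} m"
      using Henstock_Kurzweil_Integration.integral_combine[of 0 u mean m] u m_integrable
        integral_m_nonneg[of 0 u] by simp
    finally show ?thesis using D_split[of mean] mean_bounds by simp
  qed
  then have k_mean: "k mean < k0"
    using k_less[of mean "r / \<beta>"] mean_bounds \<beta> by (simp add: k0_def)
  have left: "FF mean < FF s" if s: "0 \<le> s" "s < mean" for s
  proof -
    have cont: "continuous_on {s..mean} k"
      using s mean_bounds by (intro continuous_on_subset[OF k_continuous[of mean]]) auto
    have "continuous_on {s..mean} (\<lambda>u. k0 - k u)" by (intro continuous_intros cont)
    moreover have "integral {s..mean} (\<lambda>u. k0 - k u) = (mean - s) * k0 - integral {s..mean} k"
      using s cont by (subst Henstock_Kurzweil_Integration.integral_diff)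
        (auto intro: integrable_continuous_real)
    \<comment> \<open>A continuous nonnegative function with integral 0 vanishes identically, but
      this one is positive at \<open>mean\<close>.\<close>
    moreover have "integral {s..mean} (\<lambda>u. k0 - k u) \<noteq> 0"
      using integral_eq_0_iff[of s mean "\<lambda>u. k0 - k u"] calculation(1) s k_le0 k_mean by force
    moreover have "integral {s..mean} (\<lambda>u. k0 - k u) \<ge> 0"
      using calculation(1) s k_le0
      by (intro Henstock_Kurzweil_Integration.integral_nonneg integrable_continuous_real) auto
    ultimately have "integral {s..mean} k < (mean - s) * k0" by simp
    moreover have "(mean - s) * k0 \<le> 2 * deriv (B \<nu>) (2 * (q - mean)) - 2 * deriv (B \<nu>) (2 * (q - s))"
    proof -
      have "(mean - s) * k0 \<le> (mean - s) * (- 4 * moment 2 (2 * (q - mean)))"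
        using second_derivative_nonpos[OF max] s unfolding beta_q_mean k0_def
        by (intro mult_left_mono) auto
      moreover have "deriv (B \<nu>) (2 * (q - s)) \<le> deriv (B \<nu>) (2 * (q - mean))
          + moment 2 (2 * (q - mean)) * (2 * (q - s) - 2 * (q - mean))"
        using s mean_bounds by (intro deriv_B_le_tangent) auto
      ultimately show ?thesis by (simp add: algebra_simps)
    qed
    moreover have "FF mean - FF s = - 2 * deriv (B \<nu>) (2 * (q - mean)) + 2 * deriv (B \<nu>) (2 * (q - s))
        + integral {s..mean} k"
      using FF_diff s mean_bounds by simp
    ultimately show ?thesis by simp
  qed
  \<comment> \<open>f(mean) <= f(a), so by the mean value theorem F <= 0 at some point between a and
    the mean, and F is strictly smaller at the mean.\<close>
  have "FF mean < 0"
  proof -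
    have "\<exists>l z. a < z \<and> z < mean \<and> (ff has_real_derivative l) (at z) \<and> ff mean - ff a = (mean - a) * l"
    proof (rule MVT[OF a(1)])
      show "continuous_on {a..mean} ff"
        using ff_continuous[OF mean_bounds(2)] by (rule continuous_on_subset) (use a0 in auto)
      show "ff differentiable (at x)" if "a < x" "x < mean" for x
        using ff_derivative[of x] that a0 mean_bounds by (auto simp: real_differentiable_def)
    qed
    then obtain l z where z: "a < z" "z < mean" "(ff has_real_derivative l) (at z)"
      "ff mean - ff a = (mean - a) * l" by blast
    have "l = FF z" using DERIV_unique[OF z(3) ff_derivative] z a0 mean_bounds by simp
    moreover have "ff mean \<le> ff a" using a(2) mean0 mean_bounds by (simp add: maximiser_def)
    ultimately have "(mean - a) * FF z \<le> 0" using z by simp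
    then have "FF z \<le> 0" using a(1) by (simp add: mult_le_0_iff)
    then show ?thesis using left[of z] z a0 by simp
  qed
  moreover have "FF mean \<ge> 0"
  proof -
    \<comment> \<open>Its derivative F(s) - F(mean) + g'(beta (q - s)) / beta is nonpositive by
      \<open>FF_above_mean\<close>. Since f does not drop from the mean to b and g is maximal at r,
      what remains is F(mean) (b - mean) >= 0.\<close>
    define \<Theta> where "\<Theta> s = ff s - FF mean * s - gg (\<beta> * (q - s)) / \<beta>\<^sup>2" for s
    have "\<Theta> b \<le> \<Theta> mean"
    proof (rule DERIV_nonpos_imp_nonincreasing[where f = \<Theta>])
      show "mean \<le> b" using b by simp
      fix s assume s: "mean \<le> s" "s \<le> b"
      have "(\<Theta> has_real_derivative FF s - FF mean * 1 - (- g' (\<beta> * (q - s)) / \<beta>)) (at s)"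
        unfolding \<Theta>_def[abs_def] using s bq mean0
        by (intro DERIV_diff DERIV_cmult DERIV_ident ff_derivative gg_reflected_derivative) auto
      then show "\<exists>y. (\<Theta> has_real_derivative y) (at s) \<and> y \<le> 0"
        using FF_above_mean(1)[of s] s bq by auto
    qed
    moreover have "gg (\<beta> * (q - b)) / \<beta>\<^sup>2 \<le> gg (\<beta> * (q - mean)) / \<beta>\<^sup>2"
    proof (intro divide_right_mono)
      have "\<beta> * (q - b) < \<beta> * (q - mean)" using b \<beta> by (intro mult_strict_left_mono) auto
      then show "gg (\<beta> * (q - b)) \<le> gg (\<beta> * (q - mean))"
        using max[of "\<beta> * (q - b)"] \<beta> bq unfolding beta_q_mean by simp
    qed simp
    moreover have "ff mean \<le> ff b" using b(2) mean0 mean_bounds by (simp add: maximiser_def)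
    ultimately have "0 \<le> FF mean * (b - mean)" by (simp add: \<Theta>_def algebra_simps)
    then show ?thesis using b(1) by (simp add: zero_le_mult_iff)
  qed
  ultimately show False by simp
qed

section \<open>The Dirac case: position of the atom, optimality of g, value of the
  functional\<close>

context
  fixes a :: real
  assumes dirac: "\<zeta> = return borel a"
begin

lemma m_dirac: "0 \<le> u \<Longrightarrow> m u = (if a \<le> u then 1 else 0)" and a_bounds: "0 \<le> a" "a < q"
proof -
  have meas: "measure \<zeta> A = indicator A a" if "A \<in> sets borel" for A
    using that by (simp add: dirac measure_return)
  have "a \<in> {0..q}" using m_q meas[of "{0..q}"] by (simp add: m_def indicator_def split: if_splits)
  moreover have "a \<noteq> q"
  proof
    assume "a = q"
    obtain p where "p < q" "measure \<zeta> {p..q} = 0" by (metis gap)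
    then show False using meas[of "{p..q}"] \<open>a = q\<close> by simp
  qed
  ultimately show a: "0 \<le> a" "a < q" by auto
  show "m u = (if a \<le> u then 1 else 0)" if "0 \<le> u"
    using meas[of "{0..u}"] a that by (simp add: m_def indicator_def)
qed

lemma D_above: "a \<le> s \<Longrightarrow> s \<le> q \<Longrightarrow> D s = q - s"
proof -
  assume s: "a \<le> s" "s \<le> q"
  have "integral {s..q} m = integral {s..q} (\<lambda>_. 1)"
    using s a_bounds by (intro Henstock_Kurzweil_Integration.integral_cong) (auto simp: m_dirac)
  then show ?thesis using s by (simp add: D_eq)
qed

lemma D_below: "0 \<le> s \<Longrightarrow> s \<le> a \<Longrightarrow> D s = r / \<beta>"
proof -
  assume s: "0 \<le> s" "s \<le> a"
  have "integral {0..s} m = integral {0..s} (\<lambda>_. 0)"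
    by (rule integral_spike[of "{a}"]) (use s in \<open>auto simp: m_dirac\<close>)
  then show ?thesis using s D_split a_bounds by simp
qed

text \<open>At the atom both formulas for \<open>D\<close> apply, and equating them locates
  it.\<close>

lemma mean_dirac: "mean = a"
  using D_above[of a] D_below[of a] a_bounds by (simp add: mean_def)

lemma maximiser_dirac: "maximiser a"
proof -
  have "measure \<zeta> {a} > 0" by (simp add: dirac measure_return)
  then show ?thesis using maximiser_exists[of "{a}"] by simp
qed

lemma FF_dirac: "FF a = - 2 * deriv (B \<nu>) (2 / \<beta> * r) + a * deriv (K L d t) r"
proof -
  have "integral {0..a} k = integral {0..a} (\<lambda>_. deriv (K L d t) r)"
    using \<beta> by (intro Henstock_Kurzweil_Integration.integral_cong) (auto simp: k_def D_below)
  then show ?thesis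
    using a_bounds beta_q_mean(2) by (simp add: FF_eq mean_dirac)
qed

text \<open>An interior atom is a local maximum of f. An atom at 0 gives only F(0) <= 0, but then
  F(0) = -2 B'(2 r / beta), which is nonnegative.\<close>

lemma FF_dirac_zero: "FF a = 0"
proof (cases "a = 0")
  case False
  then have a: "0 < a" "a < q" using a_bounds by auto
  show ?thesis
  proof (rule DERIV_local_max[OF ff_derivative[OF a]])
    show "0 < min a (q - a)" using a by simp
    show "\<forall>y. \<bar>a - y\<bar> < min a (q - a) \<longrightarrow> ff y \<le> ff a"
      using maximiser_dirac by (auto simp: maximiser_def abs_if split: if_splits)
  qed
next
  case True
  have "FF a \<ge> 0"
    using FF_dirac True deriv_B_nonpos[of "2 / \<beta> * r"] r_pos \<beta> by simp
  moreover have "\<not> FF a > 0"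
  proof
    assume "FF a > 0"
    then obtain e where e: "e > 0" "\<And>h. h > 0 \<Longrightarrow> 0 + h \<in> {0..q / 2} \<Longrightarrow> h < e \<Longrightarrow> ff 0 < ff (0 + h)"
      using has_real_derivative_pos_inc_right[OF ff_derivative_within[of "q / 2" 0]] q_pos True by auto
    define h where "h = min (e / 2) (q / 2)"
    have "ff 0 < ff h" using e(2)[of h] e(1) q_pos by (simp add: h_def min_def)
    moreover have "ff h \<le> ff 0"
      using maximiser_dirac True e(1) q_pos by (simp add: maximiser_def h_def min_def)
    ultimately show False by simp
  qed
  ultimately show ?thesis by simp
qed

text \<open>To the right of the atom, F(a) = 0 and the equality case of \<open>FF_above_mean\<close>
  make f and g(beta (q - s)) / beta^2 have the same derivative. They differ by a constant, so the
  maximality of f at a passes to g at r.\<close>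

lemma gg_max_dirac:
  assumes "0 < x" "x < r" shows "gg x \<le> gg r"
proof -
  define s where "s = q - x / \<beta>"
  have x: "x = \<beta> * (q - s)" using \<beta> by (simp add: s_def)
  have s: "a < s" "s < q"
  proof -
    have "x / \<beta> < r / \<beta>" using assms \<beta> by (intro divide_strict_right_mono)
    then show "a < s" using mean_dirac by (simp add: s_def mean_def)
    show "s < q" using assms \<beta> by (simp add: s_def)
  qed
  define \<Theta> where "\<Theta> s = ff s - gg (\<beta> * (q - s)) / \<beta>\<^sup>2" for s
  have "\<Theta> s = \<Theta> a"
  proof (rule DERIV_isconst_end[OF s(1)])
    have "continuous_on {a..s} ff"
      using ff_continuous[OF s(2)] by (rule continuous_on_subset) (use a_bounds in auto)
    moreover have "continuous_on {a..s} (\<lambda>s. gg (\<beta> * (q - s)) / \<beta>\<^sup>2)"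
      using s by (intro continuous_at_imp_continuous_on ballI DERIV_isCont[OF gg_reflected_derivative]) auto
    ultimately show "continuous_on {a..s} \<Theta>"
      unfolding \<Theta>_def[abs_def] by (rule continuous_on_diff)
    fix y assume y: "a < y" "y < s"
    have "FF y = - g' (\<beta> * (q - y)) / \<beta>"
      using FF_above_mean(2)[of y] y s D_above FF_dirac_zero by (simp add: mean_dirac)
    moreover have "(\<Theta> has_real_derivative FF y - (- g' (\<beta> * (q - y)) / \<beta>)) (at y)"
      unfolding \<Theta>_def[abs_def] using y s a_bounds
      by (intro DERIV_diff ff_derivative gg_reflected_derivative) auto
    ultimately show "(\<Theta> has_real_derivative 0) (at y)" by simp
  qed
  moreover have "ff s \<le> ff a" using maximiser_dirac s a_bounds by (simp add: maximiser_def)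
  ultimately have "gg x / \<beta>\<^sup>2 \<le> gg r / \<beta>\<^sup>2"
    using beta_q_mean(1) by (simp add: \<Theta>_def x mean_dirac)
  then show ?thesis using \<beta> by (simp add: divide_le_cancel)
qed

text \<open>F(a) = 0 is linear in a, and K'(r) = - 1 / R_2(mu).\<close>

lemma a_eq_qL: "a = qL L d \<mu> t \<nu> \<beta>"
proof -
  have "deriv (K L d t) r = - 1 / R L d t 2 \<mu>"
    using deriv_K[OF r_pos] by (simp add: K_r)
  then show ?thesis
    using FF_dirac FF_dirac_zero R_two_pos[OF \<mu>] by (simp add: qL_def r_def field_simps)
qed

lemma q_eq: "q = a + r / \<beta>"
  using mean_dirac by (simp add: mean_def)

text \<open>Both integrals are split at the atom. The term at q_* cancels against the primitive G of
  K, and beta mu q cancels against a beta mu + r mu. The log determinant of G(r) survives with its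
  minus sign, and the field term beta h^2 / mu is carried along.\<close>

lemma parisi_dirac:
  "parisi L d \<mu> t h \<nu> \<beta> q \<zeta> = 1/2 *
     (ln (2 * pi / \<beta>) + \<beta> * h\<^sup>2 / \<mu> - 1 / real (L ^ d) * logdet L d t \<mu>
      + \<beta>\<^sup>2 * (B \<nu> 0 - B \<nu> (2 / \<beta> * r)))"
proof -
  \<comment> \<open>The value chosen by \<open>SOME\<close> in \<open>parisi\<close>; all that is
    known of it is admissibility.\<close>
  define p where "p = (SOME qs. 0 < qs \<and> qs < q \<and> measure \<zeta> {qs..q} = 0)"
  have "\<exists>qs. 0 < qs \<and> qs < q \<and> measure \<zeta> {qs..q} = 0" by (metis gap)
  then have p: "0 < p" "p < q" "measure \<zeta> {p..q} = 0"
    unfolding p_def by (rule someI2_ex; simp)+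
  \<comment> \<open>An atom in [p, q] would contradict that this interval is null.\<close>
  have ap: "a < p"
    using p a_bounds by (cases "a < p") (auto simp: dirac measure_return)
  define G where "G x = x * K L d t x - 1 / real (L ^ d) * logdet L d t (K L d t x)" for x
  have I1: "((\<lambda>u. \<beta> * K L d t (\<beta> * D u)) has_integral a * \<beta> * \<mu>) {0..a}"
  proof (rule has_integral_eq)
    show "((\<lambda>_. \<beta> * \<mu>) has_integral a * \<beta> * \<mu>) {0..a}"
      using has_integral_const_real[of "\<beta> * \<mu>" 0 a] a_bounds by (simp add: mult.assoc)
  qed (use \<beta> K_r in \<open>auto simp: D_below\<close>)
  have I2: "((\<lambda>u. \<beta> * K L d t (\<beta> * D u)) has_integral G r - G (\<beta> * (q - p))) {a..p}"
  proof (rule has_integral_eq)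
    have "((\<lambda>u. - G (\<beta> * (q - u))) has_real_derivative \<beta> * K L d t (\<beta> * (q - u))) (at u within {a..p})"
      if "u \<in> {a..p}" for u
    proof -
      have "((\<lambda>u. G (\<beta> * (q - u))) has_real_derivative K L d t (\<beta> * (q - u)) * (- \<beta>)) (at u within {a..p})"
        unfolding G_def
        by (rule DERIV_chain2[OF K_primitive])
          (use p \<beta> that in \<open>auto intro!: derivative_eq_intros\<close>)
      then show ?thesis by (auto intro!: derivative_eq_intros)
    qed
    then have "((\<lambda>u. \<beta> * K L d t (\<beta> * (q - u))) has_integral
        (- G (\<beta> * (q - p)) - (- G (\<beta> * (q - a))))) {a..p}"
      using ap by (intro fundamental_theorem_of_calculus)
        (auto simp: has_real_derivative_iff_has_vector_derivative)
    then show "((\<lambda>u. \<beta> * K L d t (\<beta> * (q - u))) has_integral G r - G (\<beta> * (q - p))) {a..p}"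
      using beta_q_mean(1) by (simp add: mean_dirac)
  qed (use p in \<open>auto simp: D_above\<close>)
  have int_K: "integral {0..p} (\<lambda>u. \<beta> * K L d t (\<beta> * D u)) = a * \<beta> * \<mu> + (G r - G (\<beta> * (q - p)))"
    using integral_unique[OF has_integral_combine[OF _ _ I1 I2]] a_bounds ap by simp
  have "((\<lambda>u. - B \<nu> (2 * (q - u)) / 2) has_real_derivative deriv (B \<nu>) (2 * (q - u))) (at u within {a..q})"
    if "u \<in> {a..q}" for u
  proof -
    have "((\<lambda>u. B \<nu> (2 * (q - u))) has_real_derivative deriv (B \<nu>) (2 * (q - u)) * (- 2)) (at u within {a..q})"
      by (rule DERIV_chain2[OF B_has_derivative])
        (use that in \<open>auto intro!: derivative_eq_intros\<close>)
    then show ?thesis by (auto intro!: derivative_eq_intros)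
  qed
  then have "((\<lambda>u. deriv (B \<nu>) (2 * (q - u))) has_integral
      (- B \<nu> (2 * (q - q)) / 2 - (- B \<nu> (2 * (q - a)) / 2))) {a..q}"
    using a_bounds by (intro fundamental_theorem_of_calculus)
      (auto simp: has_real_derivative_iff_has_vector_derivative)
  then have "((\<lambda>u. deriv (B \<nu>) (2 * (q - u))) has_integral (B \<nu> (2 / \<beta> * r) - B \<nu> 0) / 2) {a..q}"
    using beta_q_mean(2) by (simp add: mean_dirac diff_divide_distrib)
  then have J2: "((\<lambda>u. m u * deriv (B \<nu>) (2 * (q - u))) has_integral (B \<nu> (2 / \<beta> * r) - B \<nu> 0) / 2) {a..q}"
    by (rule has_integral_eq[rotated]) (use a_bounds m_dirac in auto)
  have J1: "((\<lambda>u. m u * deriv (B \<nu>) (2 * (q - u))) has_integral 0) {0..a}"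
    by (rule has_integral_spike[of "{a}" _ _ "\<lambda>_. 0"]) (use m_dirac in auto)
  have int_B: "integral {0..q} (\<lambda>u. m u * deriv (B \<nu>) (2 * (q - u))) = (B \<nu> (2 / \<beta> * r) - B \<nu> 0) / 2"
    using integral_unique[OF has_integral_combine[OF _ _ J1 J2]] a_bounds by simp
  have "parisi L d \<mu> t h \<nu> \<beta> q \<zeta> = 1/2 *
     (ln (2 * pi / \<beta>) + \<beta> * h\<^sup>2 / \<mu> - \<beta> * \<mu> * q + G (\<beta> * (q - p))
      + integral {0..p} (\<lambda>u. \<beta> * K L d t (\<beta> * D u))
      - 2 * \<beta>\<^sup>2 * integral {0..q} (\<lambda>u. m u * deriv (B \<nu>) (2 * (q - u))))"
    by (simp add: parisi_def p_def[symmetric] parisi_at_def G_def D_def m_def algebra_simps)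
  moreover have "G r = r * \<mu> - 1 / real (L ^ d) * logdet L d t \<mu>"
    by (simp add: G_def K_r)
  moreover have "\<beta> * \<mu> * q = a * \<beta> * \<mu> + r * \<mu>"
    using q_eq \<beta> by (simp add: algebra_simps)
  moreover have "2 * \<beta>\<^sup>2 * ((B \<nu> (2 / \<beta> * r) - B \<nu> 0) / 2)
      = - (\<beta>\<^sup>2 * (B \<nu> 0 - B \<nu> (2 / \<beta> * r)))"
    by (simp add: diff_divide_distrib right_diff_distrib)
  ultimately show ?thesis unfolding int_K int_B by simp
qed

end

end

theorem theorem1p7:
  fixes L d :: nat and \<mu> t \<beta> h :: real and \<nu> :: "real measure"
    and q\<^sub>c :: real and \<zeta>\<^sub>c :: "real measure"
  assumes "L \<ge> 1" and "\<mu> > 0" and "t > 0" and "\<beta> > 0"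
    and "spectral_measure \<nu>"
    and "saddle_pair L d \<mu> t \<nu> \<beta> q\<^sub>c \<zeta>\<^sub>c"
  shows "(replica_symmetric \<zeta>\<^sub>c \<longleftrightarrow>
           (SUP s\<in>{0<..<R L d t 1 \<mu>}. g L d \<mu> t \<nu> \<beta> s) = g L d \<mu> t \<nu> \<beta> (R L d t 1 \<mu>)) \<and>
         (replica_symmetric \<zeta>\<^sub>c \<longrightarrow>
           parisi L d \<mu> t h \<nu> \<beta> q\<^sub>c \<zeta>\<^sub>c = 1/2 *
             (ln (2 * pi / \<beta>) + \<beta> * h\<^sup>2 / \<mu>
              - 1 / real (L ^ d) * logdet L d t \<mu>
              + \<beta>\<^sup>2 * (B \<nu> 0 - B \<nu> (2 / \<beta> * R L d t 1 \<mu>))) \<and>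
           (\<zeta>\<^sub>c, q\<^sub>c) = (return borel (qL L d \<mu> t \<nu> \<beta>), qL L d \<mu> t \<nu> \<beta> + R L d t 1 \<mu> / \<beta>))"
proof -
  have "prob_space \<zeta>\<^sub>c" using assms(6) by (simp add: saddle_pair_def Y_def)
  then interpret saddle_point L d t \<nu> \<zeta>\<^sub>c \<mu> \<beta> q\<^sub>c
    using assms by (simp add: saddle_point_def saddle_point_axioms_def resolvent_def covariance_def)
  have "replica_symmetric \<zeta>\<^sub>c \<longleftrightarrow> (\<forall>x. 0 < x \<and> x < r \<longrightarrow> gg x \<le> gg r)"
    using dirac_if_gg_max gg_max_dirac by (auto simp: replica_symmetric_def)
  then have "replica_symmetric \<zeta>\<^sub>c \<longleftrightarrow> (SUP s\<in>{0<..<r}. gg s) = gg r"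
    unfolding sup_gg_iff .
  moreover have "\<zeta>\<^sub>c = return borel (qL L d \<mu> t \<nu> \<beta>) \<and> q\<^sub>c = qL L d \<mu> t \<nu> \<beta> + r / \<beta> \<and>
      parisi L d \<mu> t h \<nu> \<beta> q\<^sub>c \<zeta>\<^sub>c = 1/2 *
        (ln (2 * pi / \<beta>) + \<beta> * h\<^sup>2 / \<mu> - 1 / real (L ^ d) * logdet L d t \<mu>
         + \<beta>\<^sup>2 * (B \<nu> 0 - B \<nu> (2 / \<beta> * r)))" if rs: "replica_symmetric \<zeta>\<^sub>c"
  proof -
    obtain a where "\<zeta>\<^sub>c = return borel a" using rs by (auto simp: replica_symmetric_def)
    then show ?thesis using a_eq_qL[of a] q_eq[of a] parisi_dirac[of a h] by simp
  qed
  ultimately show ?thesis unfolding gg_def r_def prod.inject by blast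
qed

end
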